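(* Let $G$ be a co-chordal graph with co-diameter at least $3$. Then $G$ is non-trivially minimally tough if and only if $G$ is isomorphic to one of the graphs $P_4$, $K_{2,3}$, $K_{1,\ell}$, $S_{k,\ell}$, $T_{2\ell,\ell}$, or $T_{2\ell-1,\ell}$, for some integers $k\geq 1$ and $\ell \geq 2$.
   Context: All graphs are finite, simple, and undirected. A graph is chordal if it has no induced cycle of length at least $4$; a graph $G$ is co-chordal if its complement $\overline{G}$ is chordal. The distance between two vertices with no path between them is $\infty$; the diameter of a graph is the largest distance between any two of its vertices (so it is $\infty$ for disconnected graphs). The co-diameter of $G$ is the diameter of $\overline{G}$; in particular, the value $\infty$ is allowed. For a graph $H$, $c(H)$ denotes the number of connected components of $H$. A set $S\subseteq V(G)$ is a separator of $G$ if $c(G-S)\ge 2$. The toughness $\tau(G)$ of a graph $G$ is the minimum of $|S|/c(G-S)$ over all separators $S$ of $G$, with $\tau(G)=\infty$ if $G$ has no separators, that is, if $G$ is complete. (Disconnected graphs have toughness $0$.) For $t\in\mathbb{R}\cup\{\infty\}$, $G$ is minimally $t$-tough if $\tau(G)=t$ and $\tau(G-e)<t$ for every edge $e$ of $G$ ($G-e$ is obtained by deleting the edge $e$). $G$ is minimally tough if it is minimally $t$-tough for some $t\in\mathbb{R}\cup\{\infty\}$. Complete graphs and edgeless graphs are trivially minimally tough; all other minimally tough graphs are called non-trivially minimally tough. $P_4$ is the four-vertex path. $K_{m,n}$ is the complete bipartite graph with parts of sizes $m$ and $n$. $S_{a,b}$ (double star) is the graph obtained from the disjoint union of two stars $K_{1,a}$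 and $K_{1,b}$ by adding an edge between their centers (the center of $K_{1,a}$ is its vertex of degree $a$; for $a=1$ an arbitrarily chosen vertex). $T_{n,k}$ denotes the complete multipartite graph with $n$ vertices and $k$ parts whose sizes are as equal as possible; thus all parts of $T_{2\ell,\ell}$ have size $2$, and all parts of $T_{2\ell-1,\ell}$ have size $2$ except one of size $1$. *)

theory Defs
  imports "HOL-Library.Extended_Nat" "HOL-Library.Extended_Real"
begin

record 'a graph =
  verts :: "'a set"
  edges :: "'a set set"

definition simple_graph :: "'a graph \<Rightarrow> bool" where
  "simple_graph G \<longleftrightarrow>
     finite (verts G) \<and> (\<forall>e\<in>edges G. e \<subseteq> verts G \<and> card e = 2)"

definition graph_iso :: "'a graph \<Rightarrow> 'b graph \<Rightarrow> bool" (infix "\<simeq>" 50) where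
  "G \<simeq> H \<longleftrightarrow> (\<exists>f. bij_betw f (verts G) (verts H) \<and>
     (\<forall>u\<in>verts G. \<forall>v\<in>verts G. {u, v} \<in> edges G \<longleftrightarrow> {f u, f v} \<in> edges H))"

definition complement :: "'a graph \<Rightarrow> 'a graph" where
  "complement G = \<lparr>verts = verts G,
     edges = {{u, v} | u v. u \<in> verts G \<and> v \<in> verts G \<and> u \<noteq> v \<and> {u, v} \<notin> edges G}\<rparr>"

definition induced :: "'a graph \<Rightarrow> 'a set \<Rightarrow> 'a graph" where
  "induced G W = \<lparr>verts = verts G \<inter> W, edges = {e \<in> edges G. e \<subseteq> W}\<rparr>"

definition del_verts :: "'a graph \<Rightarrow> 'a set \<Rightarrow> 'a graph" where
  "del_verts G S = induced G (verts G - S)"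

definition del_edge :: "'a graph \<Rightarrow> 'a set \<Rightarrow> 'a graph" where
  "del_edge G e = \<lparr>verts = verts G, edges = edges G - {e}\<rparr>"

definition complete :: "'a graph \<Rightarrow> bool" where
  "complete G \<longleftrightarrow> (\<forall>u\<in>verts G. \<forall>v\<in>verts G. u \<noteq> v \<longrightarrow> {u, v} \<in> edges G)"

definition edgeless :: "'a graph \<Rightarrow> bool" where
  "edgeless G \<longleftrightarrow> edges G = {}"


subsection \<open>Chordality\<close>

text \<open>A cycle only for \<open>n \<ge> 3\<close>.\<close>

definition cycle_graph :: "nat \<Rightarrow> nat graph" where
  "cycle_graph n = \<lparr>verts = {..<n}, edges = {{i, Suc i mod n} | i. i < n}\<rparr>"

definition chordal :: "'a graph \<Rightarrow> bool" where
  "chordal G \<longleftrightarrow> \<not> (\<exists>n\<ge>4. \<exists>W\<subseteq>verts G. induced G W \<simeq> cycle_graph n)"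

definition co_chordal :: "'a graph \<Rightarrow> bool" where
  "co_chordal G \<longleftrightarrow> chordal (complement G)"


subsection \<open>Paths, distance and components\<close>

definition is_path :: "'a graph \<Rightarrow> 'a \<Rightarrow> 'a list \<Rightarrow> 'a \<Rightarrow> bool" where
  "is_path G u p v \<longleftrightarrow> p \<noteq> [] \<and> hd p = u \<and> last p = v \<and> distinct p \<and>
     set p \<subseteq> verts G \<and> successively (\<lambda>x y. {x, y} \<in> edges G) p"

text \<open>The infimum over the empty set in \<^typ>\<open>enat\<close> is \<open>\<infinity>\<close>.\<close>

definition distance :: "'a graph \<Rightarrow> 'a \<Rightarrow> 'a \<Rightarrow> enat" where
  "distance G u v = (INF p\<in>{p. is_path G u p v}. enat (length p - 1))"

text \<open>On a finite nonempty vertex set the suprema are maxima; the graph without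
  vertices gets diameter \<open>0\<close>.\<close>

definition diameter :: "'a graph \<Rightarrow> enat" where
  "diameter G = (SUP u\<in>verts G. SUP v\<in>verts G. distance G u v)"

definition co_diameter :: "'a graph \<Rightarrow> enat" where
  "co_diameter G = diameter (complement G)"

definition components :: "'a graph \<Rightarrow> 'a set set" where
  "components G = verts G // {(u, v). \<exists>p. is_path G u p v}"

definition num_components :: "'a graph \<Rightarrow> nat" where
  "num_components G = card (components G)"


subsection \<open>Toughness\<close>

definition separator :: "'a graph \<Rightarrow> 'a set \<Rightarrow> bool" where
  "separator G S \<longleftrightarrow> S \<subseteq> verts G \<and> num_components (del_verts G S) \<ge> 2"

text \<open>A finite graph has finitely many separators, so the infimum is a minimum, and
  it is \<open>\<infinity>\<close> if there are none.\<close>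

definition toughness :: "'a graph \<Rightarrow> ereal" where
  "toughness G = (INF S\<in>{S. separator G S}.
     ereal (real (card S) / real (num_components (del_verts G S))))"

definition minimally_t_tough :: "ereal \<Rightarrow> 'a graph \<Rightarrow> bool" where
  "minimally_t_tough t G \<longleftrightarrow>
     toughness G = t \<and> (\<forall>e\<in>edges G. toughness (del_edge G e) < t)"

text \<open>The parameter ranges over \<open>\<real> \<union> {\<infinity>}\<close>, hence the exclusion of \<open>-\<infinity>\<close>.\<close>

definition minimally_tough :: "'a graph \<Rightarrow> bool" where
  "minimally_tough G \<longleftrightarrow> (\<exists>t. t \<noteq> -\<infinity> \<and> minimally_t_tough t G)"

definition nontrivially_minimally_tough :: "'a graph \<Rightarrow> bool" where
  "nontrivially_minimally_tough G \<longleftrightarrow>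
     minimally_tough G \<and> \<not> complete G \<and> \<not> edgeless G"


subsection \<open>Graph families\<close>

definition path_graph :: "nat \<Rightarrow> nat graph" where
  "path_graph n = \<lparr>verts = {..<n}, edges = {{i, Suc i} | i. Suc i < n}\<rparr>"

definition complete_bipartite :: "nat \<Rightarrow> nat \<Rightarrow> (nat + nat) graph" where
  "complete_bipartite m n = \<lparr>verts = {..<m} <+> {..<n},
     edges = {{Inl i, Inr j} | i j. i < m \<and> j < n}\<rparr>"

definition disjoint_union :: "'a graph \<Rightarrow> 'b graph \<Rightarrow> ('a + 'b) graph" where
  "disjoint_union G H = \<lparr>verts = verts G <+> verts H,
     edges = (image Inl) ` edges G \<union> (image Inr) ` edges H\<rparr>"

definition add_edge :: "'a graph \<Rightarrow> 'a set \<Rightarrow> 'a graph" where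
  "add_edge G e = \<lparr>verts = verts G, edges = insert e (edges G)\<rparr>"

text \<open>The center of the star \<open>complete_bipartite 1 a\<close> is its vertex \<open>Inl 0\<close>.\<close>

definition double_star :: "nat \<Rightarrow> nat \<Rightarrow> ((nat + nat) + (nat + nat)) graph" where
  "double_star a b =
     add_edge (disjoint_union (complete_bipartite 1 a) (complete_bipartite 1 b))
       {Inl (Inl 0), Inr (Inl 0)}"

text \<open>The parts are the residue classes modulo \<open>k\<close>, which split \<open>{..<n}\<close> into \<open>k\<close> sets
  of sizes differing by at most one (nonempty if \<open>1 \<le> k \<le> n\<close>).\<close>

definition turan_graph :: "nat \<Rightarrow> nat \<Rightarrow> nat graph" where
  "turan_graph n k = \<lparr>verts = {..<n},
     edges = {{i, j} | i j. i < n \<and> j < n \<and> i mod k \<noteq> j mod k}\<rparr>"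

end

theory Submission imports Defs begin

text \<open>
Put \<open>t\<close> for the toughness of \<open>G\<close>. Co-diameter at least three says that \<open>G\<close> has a
dominating edge \<open>{u, v}\<close>: every other vertex is adjacent to \<open>u\<close> or to \<open>v\<close>. By a form of
Dirac's theorem on simplicial vertices of chordal graphs, applied to the complement, the
ends can be chosen such that the non-neighbours of \<open>u\<close> are independent, and those of \<open>v\<close>
as well (\<open>simplicial_dominating_edge\<close>).

Let \<open>G\<close> be minimally \<open>t\<close>-tough and not complete. Since \<open>{u, v}\<close> is dominating, the
drop of the toughness after its deletion is witnessed by a set \<open>S\<close> that leaves exactly
two components, one around each end. Hence \<open>|S| < 2 t\<close> (\<open>dominating_edge_cut\<close>),
whereas degrees of vertices that have a non-neighbour are at least \<open>2 t\<close>. The part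
outside \<open>S\<close> consists of \<open>u\<close>, \<open>v\<close>, an independent set \<open>A\<close> of private neighbours of
\<open>u\<close> and an independent set \<open>B\<close> of private neighbours of \<open>v\<close>, without edges between
\<open>A\<close> and \<open>B\<close>. If \<open>A\<close> is nonempty, deleting \<open>S \<union> {u}\<close> isolates \<open>A\<close>, so
\<open>t (|A| + 1) \<le> |S| + 1\<close>. Comparing with \<open>|S| < 2 t\<close> leaves \<open>S = {}\<close>, \<open>|A| = 1\<close>, or
\<open>|S| = 1\<close> with \<open>|A| = 2\<close>. If only one of \<open>A\<close> and \<open>B\<close> is nonempty, these cases are a
star, the complement of a matching that misses at most one vertex, and \<open>K\<^sub>2\<^sub>,\<^sub>3\<close>
(\<open>one_sided\<close>). If both are nonempty, the graph is a double star or \<open>S\<close> is nonempty;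
in the latter case \<open>S\<close> is joined to everything else, so it contains an end of a further
dominating edge, and the cut of that edge gives a contradiction (\<open>two_sided\<close>).

Conversely, in stars and double stars (including \<open>P\<^sub>4\<close>) every edge is a bridge, and for
\<open>K\<^sub>2\<^sub>,\<^sub>3\<close> and the complements of matchings on \<open>n\<close> vertices the lower bounds \<open>2 / 3\<close> and
\<open>(n - 2) / 2\<close> on the toughness fail after the deletion of any edge. Three structural predicates on the neighbourhoods, collected
in \<open>extremal_shape\<close>, mediate between these arguments and the isomorphism types.
\<close>

section \<open>Walks and components\<close>

definition walk :: "('a \<Rightarrow> 'a \<Rightarrow> bool) \<Rightarrow> 'a set \<Rightarrow> 'a list \<Rightarrow> bool" where
  "walk R W p \<longleftrightarrow> p \<noteq> [] \<and> set p \<subseteq> W \<and> successively R p"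

definition steps :: "('a \<Rightarrow> 'a \<Rightarrow> bool) \<Rightarrow> 'a set \<Rightarrow> ('a \<times> 'a) set" where
  "steps R W = {(x, y). x \<in> W \<and> y \<in> W \<and> R x y}"

lemma walk_append:
  assumes "walk R W p" "walk R W q" "R (last p) (hd q)"
  shows "walk R W (p @ q)"
  using assms by (auto simp: walk_def successively_append_iff)

lemma walk_take: "walk R W p \<Longrightarrow> 0 < k \<Longrightarrow> walk R W (take k p)"
proof -
  assume w: "walk R W p" and k: "0 < k"
  have "successively R (take k p @ drop k p)" using w by (simp add: walk_def)
  then have "successively R (take k p)" unfolding successively_append_iff by blast
  then show ?thesis using w k by (auto simp: walk_def dest: in_set_takeD)
qed

lemma walk_drop: "walk R W p \<Longrightarrow> k < length p \<Longrightarrow> walk R W (drop k p)"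
proof -
  assume w: "walk R W p" and k: "k < length p"
  have "successively R (take k p @ drop k p)" using w by (simp add: walk_def)
  then have "successively R (drop k p)" unfolding successively_append_iff by blast
  then show ?thesis using w k by (auto simp: walk_def dest: in_set_dropD)
qed

lemma walk_if_rtrancl_steps:
  assumes "(x, y) \<in> (steps R W)\<^sup>*" "x \<in> W"
  shows "\<exists>p. walk R W p \<and> hd p = x \<and> last p = y"
  using assms
proof (induction rule: rtrancl_induct)
  case base
  then show ?case by (intro exI[of _ "[x]"]) (simp add: walk_def)
next
  case (step y z)
  then obtain p where p: "walk R W p" "hd p = x" "last p = y" by blast
  have "walk R W (p @ [z])"
    using step.hyps p by (intro walk_append) (auto simp: walk_def steps_def)
  then show ?case using p by (intro exI[of _ "p @ [z]"]) (auto simp: walk_def)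
qed

lemma rtrancl_steps_if_walk:
  assumes "walk R W p"
  shows "(hd p, last p) \<in> (steps R W)\<^sup>*"
  using assms
proof (induction p rule: induct_list012)
  case (3 x y p)
  then have "(x, y) \<in> steps R W" "walk R W (y # p)"
    by (auto simp: walk_def steps_def)
  with 3 show ?case by (auto intro: converse_rtrancl_into_rtrancl)
qed (auto simp: walk_def)

text \<open>In a walk that is shortest among those whose ends satisfy \<open>Q\<close>, a repeated vertex
  or a chord would give a shortcut with the same ends.\<close>

lemma shortest_walk:
  assumes "walk R W p0" "Q (hd p0) (last p0)"
  obtains p where "walk R W p" "Q (hd p) (last p)" "distinct p"
    and "\<And>i j. i < j \<Longrightarrow> j < length p \<Longrightarrow> R (p ! i) (p ! j) \<longleftrightarrow> j = Suc i"
    and "\<And>q. walk R W q \<Longrightarrow> Q (hd q) (last q) \<Longrightarrow> length p \<le> length q"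
proof -
  obtain p where p: "walk R W p" "Q (hd p) (last p)"
    and min: "\<And>q. walk R W q \<Longrightarrow> Q (hd q) (last q) \<Longrightarrow> length p \<le> length q"
    using ex_has_least_nat[of "\<lambda>p. walk R W p \<and> Q (hd p) (last p)" p0 length] assms by blast
  have ne: "p \<noteq> []" using p by (simp add: walk_def)
  have chord: "j = Suc i" if "i < j" "j < length p" "R (p ! i) (p ! j)" for i j
  proof (rule ccontr)
    assume "j \<noteq> Suc i"
    let ?q = "take (Suc i) p @ drop j p"
    have "last (take (Suc i) p) = p ! i" "hd (drop j p) = p ! j"
      using that by (simp_all add: take_Suc_conv_app_nth hd_drop_conv_nth)
    then have "walk R W ?q"
      using that p(1) by (intro walk_append walk_take walk_drop) auto
    moreover have "hd ?q = hd p" "last ?q = last p"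
      using that ne by (cases p; simp)+
    ultimately have "length p \<le> length ?q" using min[of ?q] p by simp
    then show False using that \<open>j \<noteq> Suc i\<close> by simp
  qed
  have consec: "R (p ! i) (p ! Suc i)" if "Suc i < length p" for i
    using p(1) that by (auto simp: walk_def successively_conv_nth)
  have neq: "p ! i \<noteq> p ! j" if "i < j" "j < length p" for i j
  proof
    assume eq: "p ! i = p ! j"
    let ?q = "take i p @ drop j p"
    have "walk R W ?q \<and> hd ?q = hd p"
    proof (cases i)
      case 0
      then show ?thesis using that p(1) eq ne by (simp add: walk_drop hd_drop_conv_nth hd_conv_nth)
    next
      case (Suc k)
      have "last (take i p) = p ! k" "hd (drop j p) = p ! i"
        using that eq Suc by (simp_all add: take_Suc_conv_app_nth hd_drop_conv_nth)
      moreover have "hd (take i p) = hd p" using Suc ne by (cases p) auto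
      ultimately show ?thesis using that p(1) consec[of k] Suc ne
        by (intro conjI walk_append walk_take walk_drop) (auto simp: Suc)
    qed
    moreover have "last ?q = last p" using that by simp
    ultimately have "length p \<le> length ?q" using min[of ?q] p by simp
    then show False using that by simp
  qed
  have "distinct p"
    unfolding distinct_conv_nth using neq by (metis nat_neq_iff)
  then show thesis using that p min chord consec by metis
qed

definition linked :: "'a graph \<Rightarrow> 'a \<Rightarrow> 'a \<Rightarrow> bool" where
  "linked G x y \<longleftrightarrow> (\<exists>p. is_path G x p y)"

lemma linked_iff_rtrancl:
  "linked G x y \<longleftrightarrow> x \<in> verts G \<and> (x, y) \<in> (steps (\<lambda>x y. {x, y} \<in> edges G) (verts G))\<^sup>*"
  (is "_ \<longleftrightarrow> _ \<and> _ \<in> (steps ?R ?V)\<^sup>*")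
proof
  assume "linked G x y"
  then obtain p where p: "is_path G x p y" by (auto simp: linked_def)
  then have "walk ?R ?V p" "hd p = x" "last p = y" by (auto simp: is_path_def walk_def)
  then show "x \<in> ?V \<and> (x, y) \<in> (steps ?R ?V)\<^sup>*"
    using rtrancl_steps_if_walk[of ?R ?V p] by (auto simp: walk_def)
next
  assume "x \<in> ?V \<and> (x, y) \<in> (steps ?R ?V)\<^sup>*"
  then obtain p0 where "walk ?R ?V p0" "hd p0 = x \<and> last p0 = y"
    using walk_if_rtrancl_steps by metis
  from shortest_walk[of ?R ?V p0 "\<lambda>a b. a = x \<and> b = y", OF this]
  obtain p where "walk ?R ?V p" "hd p = x \<and> last p = y" "distinct p" by metis
  then show "linked G x y" by (auto simp: linked_def is_path_def walk_def)
qed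

lemma linked_refl: "x \<in> verts G \<Longrightarrow> linked G x x"
  by (simp add: linked_iff_rtrancl)

lemma linked_edge: "{x, y} \<in> edges G \<Longrightarrow> x \<in> verts G \<Longrightarrow> y \<in> verts G \<Longrightarrow> linked G x y"
  by (auto simp: linked_iff_rtrancl steps_def)

lemma linked_trans: "linked G x y \<Longrightarrow> linked G y z \<Longrightarrow> linked G x z"
  by (auto simp: linked_iff_rtrancl)

lemma linked_sym: "linked G x y \<Longrightarrow> linked G y x"
proof -
  assume "linked G x y"
  then have *: "x \<in> verts G" "(x, y) \<in> (steps (\<lambda>x y. {x, y} \<in> edges G) (verts G))\<^sup>*"
    by (auto simp: linked_iff_rtrancl)
  from *(2) show ?thesis
  proof (induction rule: rtrancl_induct)
    case base
    then show ?case using * by (simp add: linked_refl)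
  next
    case (step y z)
    then have "linked G z y" by (intro linked_edge) (auto simp: steps_def insert_commute)
    then show ?case using step linked_trans by metis
  qed
qed

lemma linked_closed:
  assumes "linked G x y" "x \<in> K"
    and "\<And>a b. a \<in> K \<Longrightarrow> a \<in> verts G \<Longrightarrow> b \<in> verts G \<Longrightarrow> {a, b} \<in> edges G \<Longrightarrow> b \<in> K"
  shows "y \<in> K"
proof -
  have "(x, y) \<in> (steps (\<lambda>x y. {x, y} \<in> edges G) (verts G))\<^sup>*"
    using assms by (auto simp: linked_iff_rtrancl)
  then show ?thesis
    by (induction rule: rtrancl_induct) (use assms in \<open>auto simp: steps_def\<close>)
qed

text \<open>Numbers of components are only ever estimated, from below by pairwise unlinked
  vertices and from above by vertices reaching everything.\<close>

lemma num_components_ge: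
  assumes "finite (verts G)" "I \<subseteq> verts G"
    and "\<And>x y. x \<in> I \<Longrightarrow> y \<in> I \<Longrightarrow> x \<noteq> y \<Longrightarrow> \<not> linked G x y"
  shows "card I \<le> num_components G"
proof -
  let ?r = "{(u, v). \<exists>p. is_path G u p v}"
  have r: "?r `` {x} = Collect (linked G x)" for x by (auto simp: linked_def)
  have "inj_on (\<lambda>x. ?r `` {x}) I"
  proof (rule inj_onI, rule ccontr)
    fix x y assume xy: "x \<in> I" "y \<in> I" "?r `` {x} = ?r `` {y}" "x \<noteq> y"
    have "linked G y y" using xy assms(2) by (blast intro: linked_refl)
    then have "linked G x y" using xy(3) unfolding r by blast
    then show False using assms(3) xy by blast
  qed
  moreover have "(\<lambda>x. ?r `` {x}) ` I \<subseteq> components G"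
    using assms(2) by (auto simp: components_def quotient_def)
  moreover have "finite (components G)"
    using assms(1) by (auto simp: components_def quotient_def)
  ultimately show ?thesis
    unfolding num_components_def by (metis card_image card_mono)
qed

lemma num_components_le:
  assumes "finite I" and "\<And>x. x \<in> verts G \<Longrightarrow> \<exists>y\<in>I. linked G x y"
  shows "num_components G \<le> card I"
proof -
  let ?r = "{(u, v). \<exists>p. is_path G u p v}"
  have r: "?r `` {x} = Collect (linked G x)" for x by (auto simp: linked_def)
  have "components G \<subseteq> (\<lambda>x. ?r `` {x}) ` I"
  proof
    fix c assume "c \<in> components G"
    then obtain x where x: "x \<in> verts G" "c = ?r `` {x}"
      by (auto simp: components_def quotient_def)
    then obtain y where y: "y \<in> I" "linked G x y" using assms by blast
    have "c = ?r `` {y}"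
      unfolding x r using y by (blast intro: linked_sym linked_trans)
    then show "c \<in> (\<lambda>x. ?r `` {x}) ` I" using y by blast
  qed
  then show ?thesis
    unfolding num_components_def using assms(1)
    by (meson card_image_le card_mono finite_imageI le_trans)
qed

lemma num_components_le_card_verts:
  "finite (verts G) \<Longrightarrow> num_components G \<le> card (verts G)"
  by (rule num_components_le) (auto intro: linked_refl)

section \<open>Simplicial vertices of chordal graphs\<close>

definition induced_cycle :: "('a \<Rightarrow> 'a \<Rightarrow> bool) \<Rightarrow> 'a list \<Rightarrow> bool" where
  "induced_cycle R p \<longleftrightarrow> distinct p \<and> 4 \<le> length p \<and>
     (\<forall>i j. i < j \<and> j < length p \<longrightarrow>
        (R (p ! i) (p ! j) \<longleftrightarrow> j = Suc i \<or> i = 0 \<and> j = length p - 1))"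

definition simplicial :: "('a \<Rightarrow> 'a \<Rightarrow> bool) \<Rightarrow> 'a set \<Rightarrow> 'a \<Rightarrow> bool" where
  "simplicial R W y \<longleftrightarrow> y \<in> W \<and> (\<forall>a\<in>W. \<forall>b\<in>W. R y a \<and> R y b \<and> a \<noteq> b \<longrightarrow> R a b)"

definition connected_in :: "('a \<Rightarrow> 'a \<Rightarrow> bool) \<Rightarrow> 'a set \<Rightarrow> bool" where
  "connected_in R X \<longleftrightarrow> (\<forall>x\<in>X. \<forall>y\<in>X. (x, y) \<in> (steps R X)\<^sup>*)"

text \<open>A shortest walk from \<open>C\<close> to \<open>X\<close> through \<open>y\<close>, starting and ending at neighbours
  of \<open>x\<close>, meets the neighbourhood of \<open>x\<close> in its ends only; if \<open>x\<close> and \<open>y\<close> were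
  non-adjacent, then \<open>x\<close> would close it to an induced cycle of length at least four.\<close>

lemma common_neighbours_of_connected_sets_adjacent:
  assumes sym: "symp R"
    and no: "\<And>p. set p \<subseteq> W \<Longrightarrow> \<not> induced_cycle R p"
    and sub: "C \<subseteq> W" "X \<subseteq> W" "x \<in> W" "y \<in> W"
    and con: "connected_in R C" "connected_in R X"
    and sep: "C \<inter> X = {}" "\<And>c w. c \<in> C \<Longrightarrow> w \<in> X \<Longrightarrow> \<not> R c w"
    and out: "x \<notin> C" "x \<notin> X" "y \<notin> C" "y \<notin> X" "x \<noteq> y"
    and nb: "\<exists>c\<in>C. R x c" "\<exists>c\<in>C. R y c" "\<exists>w\<in>X. R x w" "\<exists>w\<in>X. R y w"
  shows "R x y"
proof (rule ccontr)
  assume nxy: "\<not> R x y"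
  obtain c c' w w' where c: "c \<in> C" "R x c" "c' \<in> C" "R y c'"
    and w: "w \<in> X" "R x w" "w' \<in> X" "R y w'" using nb by blast
  let ?U = "C \<union> X \<union> {y}"
  let ?Q = "\<lambda>a b. a \<in> C \<and> R x a \<and> b \<in> X \<and> R x b"
  have sub_steps: "steps R A \<subseteq> steps R ?U" if "A \<subseteq> ?U" for A
    using that by (auto simp: steps_def)
  have "(c, c') \<in> (steps R ?U)\<^sup>*" "(w', w) \<in> (steps R ?U)\<^sup>*"
    using con c w rtrancl_mono[OF sub_steps, of C] rtrancl_mono[OF sub_steps, of X]
    unfolding connected_in_def by blast+
  moreover have "(c', y) \<in> steps R ?U" "(y, w') \<in> steps R ?U"
    using c w sym by (auto simp: steps_def dest: sympD)
  ultimately have "(c, w) \<in> (steps R ?U)\<^sup>*"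
    by (meson rtrancl.rtrancl_into_rtrancl rtrancl_trans)
  then obtain p0 where "walk R ?U p0" "hd p0 = c" "last p0 = w"
    using walk_if_rtrancl_steps[of c w R ?U] c by blast
  then obtain p where p: "walk R ?U p" "?Q (hd p) (last p)" "distinct p"
    and chord: "\<And>i j. i < j \<Longrightarrow> j < length p \<Longrightarrow> R (p ! i) (p ! j) \<longleftrightarrow> j = Suc i"
    and min: "\<And>q. walk R ?U q \<Longrightarrow> ?Q (hd q) (last q) \<Longrightarrow> length p \<le> length q"
    using shortest_walk[of R ?U p0 ?Q] c w by metis
  have ne: "p \<noteq> []" and U: "set p \<subseteq> ?U" using p(1) by (auto simp: walk_def)
  have ends: "hd p = p ! 0" "last p = p ! (length p - 1)"
    using ne by (simp_all add: hd_conv_nth last_conv_nth)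
  have l1: "length p \<noteq> 1" using p(2) sep(1) ends by auto
  have l2: "length p \<noteq> 2" using p(2) sep(2) ends chord[of 0 1] by auto
  have len: "3 \<le> length p" using ne l1 l2 by (cases "length p") auto
  have inner: "\<not> R x (p ! i)" if i: "0 < i" "i < length p - 1" for i
  proof
    assume Rx: "R x (p ! i)"
    have "p ! i \<in> ?U" using U i by (meson less_imp_diff_less nth_mem subsetD less_le_trans diff_le_self)
    moreover have "p ! i \<noteq> y" using Rx nxy by auto
    ultimately consider "p ! i \<in> C" | "p ! i \<in> X" by blast
    then show False
    proof cases
      case 1
      have "length p \<le> length (drop i p)"
        using i p 1 Rx by (intro min walk_drop) (auto simp: hd_drop_conv_nth)
      then show False using i by simp
    next
      case 2
      have "last (take (Suc i) p) = p ! i" using i by (simp add: take_Suc_conv_app_nth)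
      moreover have "hd (take (Suc i) p) = hd p" using ne by (cases p) auto
      ultimately have "length p \<le> length (take (Suc i) p)"
        using i p 2 Rx by (intro min walk_take) auto
      then show False using i by simp
    qed
  qed
  have Rx: "R x (p ! j) \<longleftrightarrow> j = 0 \<or> j = length p - 1" if "j < length p" for j
  proof (cases "j = 0 \<or> j = length p - 1")
    case True
    then show ?thesis using p(2) ends by auto
  next
    case False
    then have "0 < j" "j < length p - 1" using that by linarith+
    then show ?thesis using inner False by blast
  qed
  have "induced_cycle R (x # p)"
    unfolding induced_cycle_def
  proof (intro conjI allI impI)
    show "distinct (x # p)" using p(3) U out by auto
    show "4 \<le> length (x # p)" using len by simp
    fix i j assume ij: "i < j \<and> j < length (x # p)"
    then obtain j' where j': "j = Suc j'" "j' < length p" by (cases j) auto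
    show "R ((x # p) ! i) ((x # p) ! j) \<longleftrightarrow> j = Suc i \<or> i = 0 \<and> j = length (x # p) - 1"
    proof (cases i)
      case 0
      then show ?thesis using Rx[of j'] j' len by auto
    next
      case (Suc i')
      then show ?thesis using chord[of i' j'] ij j' by auto
    qed
  qed
  moreover have "set (x # p) \<subseteq> W" using U sub by auto
  ultimately show False using no by blast
qed

text \<open>Dirac's theorem in a form that locates the simplicial vertex. For a component
  \<open>C\<close> of the graph outside the closed neighbourhood of \<open>X\<close>, the set \<open>T\<close> of its
  neighbours is a clique by the preceding lemma, and \<open>C \<union> T\<close> contains all neighbours
  of vertices of \<open>C\<close>. A simplicial vertex of the smaller graph on \<open>C \<union> T\<close> that misses
  some vertex of \<open>T\<close>, or misses some vertex when \<open>T\<close> is joined to everything, lies in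
  \<open>C\<close>.\<close>

lemma simplicial_vertex_far_from_connected_set:
  assumes sym: "symp R"
    and fin: "finite W"
    and no: "\<And>p. set p \<subseteq> W \<Longrightarrow> \<not> induced_cycle R p"
    and X: "X \<subseteq> W" "X \<noteq> {}" "connected_in R X"
    and z: "z \<in> W" "z \<notin> X" "\<forall>x\<in>X. \<not> R x z"
  shows "\<exists>y\<in>W - X. (\<forall>x\<in>X. \<not> R x y) \<and> simplicial R W y"
  using fin no X z
proof (induction "card W" arbitrary: W X z rule: less_induct)
  case less
  \<comment> \<open>\<open>C\<close> is the component of \<open>z\<close> in the graph on \<open>W0\<close>.\<close>
  define W0 where "W0 = {w \<in> W - X. \<forall>x\<in>X. \<not> R x w}"
  define C where "C = {c. (z, c) \<in> (steps R W0)\<^sup>*}"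
  define T where "T = {t \<in> W - C. \<exists>c\<in>C. R t c}"
  have z: "z \<in> W0" using less.prems by (auto simp: W0_def)
  then have zC: "z \<in> C" by (simp add: C_def)
  have CW0: "C \<subseteq> W0"
  proof
    fix c assume "c \<in> C"
    then have "(z, c) \<in> (steps R W0)\<^sup>*" by (simp add: C_def)
    then show "c \<in> W0" by (induction rule: rtrancl_induct) (auto simp: z steps_def)
  qed
  have Cstep: "b \<in> C" if "a \<in> C" "R a b" "b \<in> W0" for a b
    using that CW0 unfolding C_def steps_def by (auto intro: rtrancl_into_rtrancl)
  have zc: "(z, c) \<in> (steps R C)\<^sup>*" if "c \<in> C" for c
  proof -
    have "(z, c) \<in> (steps R W0)\<^sup>*" using that by (simp add: C_def)
    then have "(z, c) \<in> (steps R C)\<^sup>* \<and> c \<in> C"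
    proof (induction rule: rtrancl_induct)
      case base
      then show ?case using zC by simp
    next
      case (step a b)
      then have "b \<in> C" using Cstep by (auto simp: steps_def)
      moreover have "(a, b) \<in> steps R C" using step \<open>b \<in> C\<close> by (auto simp: steps_def)
      ultimately show ?case using step by (meson rtrancl.rtrancl_into_rtrancl)
    qed
    then show ?thesis ..
  qed
  have conC: "connected_in R C"
    unfolding connected_in_def
  proof (intro ballI)
    fix a b assume ab: "a \<in> C" "b \<in> C"
    have "(steps R C)\<inverse> = steps R C" using sym by (auto simp: steps_def dest: sympD)
    then have "(a, z) \<in> (steps R C)\<^sup>*" using zc[OF ab(1)] by (metis rtrancl_converseI)
    then show "(a, b) \<in> (steps R C)\<^sup>*" using zc[OF ab(2)] by (meson rtrancl_trans)
  qed
  have CX: "C \<inter> X = {}" and nCX: "\<And>c w. c \<in> C \<Longrightarrow> w \<in> X \<Longrightarrow> \<not> R c w"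
    using CW0 sym by (auto simp: W0_def dest: sympD)
  have CW: "C \<subseteq> W" and TW: "T \<subseteq> W" using CW0 by (auto simp: W0_def T_def)
  have TX: "t \<notin> X" "\<exists>w\<in>X. R t w" if t: "t \<in> T" for t
  proof -
    obtain c where c: "c \<in> C" "R t c" "t \<notin> C" "t \<in> W" using t unfolding T_def by blast
    show "t \<notin> X" using c nCX sym by (auto dest: sympD)
    then have "t \<notin> W0 \<Longrightarrow> \<exists>w\<in>X. R t w" using c sym by (auto simp: W0_def dest: sympD)
    moreover have "t \<notin> W0" using c Cstep[of c t] sym by (auto dest: sympD)
    ultimately show "\<exists>w\<in>X. R t w" by blast
  qed
  have Tclique: "R s t" if "s \<in> T" "t \<in> T" "s \<noteq> t" for s t
    by (rule common_neighbours_of_connected_sets_adjacent[OF sym less.prems(2), where C = C and X = X])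
      (use that TX CW TW conC CX nCX less.prems in \<open>auto simp: T_def\<close>)
  let ?W = "C \<union> T"
  have nbC: "b \<in> ?W" if "a \<in> C" "b \<in> W" "R a b" for a b
    using that sym by (auto simp: T_def dest: sympD)
  have lift: "simplicial R W y" if "y \<in> C" "simplicial R ?W y" for y
    using that nbC CW unfolding simplicial_def by blast
  have goal: ?case if "y \<in> C" "simplicial R ?W y" for y
    using lift[OF that] that(1) CW0 by (auto simp: W0_def)
  have smaller: "card ?W < card W"
    using less.prems CX TX CW TW by (intro psubset_card_mono) auto
  have IH: "\<exists>y\<in>?W. y \<noteq> a \<and> \<not> R a y \<and> simplicial R ?W y"
    if "a \<in> ?W" "b \<in> ?W" "a \<noteq> b" "\<not> R a b" for a b
  proof -
    have "\<exists>y\<in>?W - {a}. (\<forall>x\<in>{a}. \<not> R x y) \<and> simplicial R ?W y"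
    proof (rule less.hyps[OF smaller])
      show "finite ?W" using less.prems CW TW by (meson finite_subset Un_least)
      show "\<not> induced_cycle R p" if "set p \<subseteq> ?W" for p
        using less.prems that CW TW by blast
      show "connected_in R {a}" by (simp add: connected_in_def)
    qed (use that in auto)
    then show ?thesis by auto
  qed
  show ?case
  proof (cases "\<exists>a\<in>T. \<exists>b\<in>?W. a \<noteq> b \<and> \<not> R a b")
    case True
    then obtain a b where a: "a \<in> T" "b \<in> ?W" "a \<noteq> b" "\<not> R a b" by blast
    then obtain y where "y \<in> ?W" "y \<noteq> a" "\<not> R a y" "simplicial R ?W y" using IH[of a b] by blast
    then show ?thesis using goal Tclique a by blast
  next
    case T: False
    show ?thesis
    proof (cases "\<exists>a\<in>C. \<exists>b\<in>C. a \<noteq> b \<and> \<not> R a b")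
      case True
      then obtain a b where a: "a \<in> C" "b \<in> C" "a \<noteq> b" "\<not> R a b" by blast
      then obtain y where "y \<in> ?W" "y \<noteq> a" "\<not> R a y" "simplicial R ?W y" using IH[of a b] by blast
      then show ?thesis using goal T a sym by (metis UnE UnI1 sympD)
    next
      case False
      have "R a b" if "a \<in> ?W" "b \<in> ?W" "a \<noteq> b" for a b
        using that T False sym by (metis UnE sympD)
      then have "simplicial R ?W z" using zC by (auto simp: simplicial_def)
      then show ?thesis using goal zC by blast
    qed
  qed
qed

lemma simplicial_vertex_exists:
  assumes "symp R" "finite W" "W \<noteq> {}"
    and "\<And>p. set p \<subseteq> W \<Longrightarrow> \<not> induced_cycle R p"
  shows "\<exists>y. simplicial R W y"
proof (cases "\<exists>a\<in>W. \<exists>b\<in>W. a \<noteq> b \<and> \<not> R a b")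
  case True
  then obtain a b where "a \<in> W" "b \<in> W" "a \<noteq> b" "\<not> R a b" by blast
  then show ?thesis
    using simplicial_vertex_far_from_connected_set[of R W "{a}" b] assms
    by (auto simp: connected_in_def)
next
  case False
  then show ?thesis using assms(3) unfolding simplicial_def by blast
qed

lemma no_induced_cycle_if_chordal:
  assumes "chordal H" "simple_graph H" "set p \<subseteq> verts H"
  shows "\<not> induced_cycle (\<lambda>x y. {x, y} \<in> edges H) p"
proof
  let ?R = "\<lambda>x y. {x, y} \<in> edges H"
  assume cyc: "induced_cycle ?R p"
  let ?n = "length p"
  have d: "distinct p" and n: "4 \<le> ?n"
    and R: "\<And>i j. i < j \<Longrightarrow> j < ?n \<Longrightarrow> ?R (p ! i) (p ! j) \<longleftrightarrow> j = Suc i \<or> i = 0 \<and> j = ?n - 1"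
    using cyc by (auto simp: induced_cycle_def)
  have bij: "bij_betw ((!) p) {..<?n} (set p)" using d by (simp add: bij_betw_nth)
  define f where "f = the_inv_into {..<?n} ((!) p)"
  have fb: "bij_betw f (set p) {..<?n}" unfolding f_def by (rule bij_betw_the_inv_into[OF bij])
  have fp: "f (p ! i) = i" if "i < ?n" for i
    unfolding f_def using bij that by (intro the_inv_into_f_f) (auto simp: bij_betw_def)
  have cedge: "{i, j} \<in> edges (cycle_graph ?n) \<longleftrightarrow> j = Suc i \<or> i = 0 \<and> j = ?n - 1"
    if ij: "i < j" "j < ?n" for i j
  proof
    assume "{i, j} \<in> edges (cycle_graph ?n)"
    then obtain k where k: "k < ?n" "{i, j} = {k, Suc k mod ?n}" by (auto simp: cycle_graph_def)
    show "j = Suc i \<or> i = 0 \<and> j = ?n - 1"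
    proof (cases "Suc k = ?n")
      case True
      then have "{i, j} = {k, 0}" using k by simp
      then show ?thesis using ij True by (auto simp: doubleton_eq_iff)
    next
      case False
      then have "{i, j} = {k, Suc k}" using k by simp
      then show ?thesis using ij by (auto simp: doubleton_eq_iff)
    qed
  next
    assume "j = Suc i \<or> i = 0 \<and> j = ?n - 1"
    then show "{i, j} \<in> edges (cycle_graph ?n)"
    proof
      assume "j = Suc i"
      then have "{i, j} = {i, Suc i mod ?n} \<and> i < ?n" using ij by simp
      then show ?thesis by (auto simp: cycle_graph_def)
    next
      assume "i = 0 \<and> j = ?n - 1"
      moreover have "Suc (?n - 1) = ?n" using n by simp
      ultimately have "{i, j} = {?n - 1, Suc (?n - 1) mod ?n} \<and> ?n - 1 < ?n"
        by (simp add: insert_commute)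
      then show ?thesis unfolding cycle_graph_def by auto
    qed
  qed
  have lt: "{p ! i, p ! j} \<in> edges (induced H (set p)) \<longleftrightarrow> {i, j} \<in> edges (cycle_graph ?n)"
    if "i < j" "j < ?n" for i j
    using that cedge[of i j] R[of i j] by (auto simp: induced_def)
  have eq: "{p ! i, p ! j} \<in> edges (induced H (set p)) \<longleftrightarrow> {i, j} \<in> edges (cycle_graph ?n)"
    if ij: "i < ?n" "j < ?n" for i j
  proof (cases i j rule: linorder_cases)
    case equal
    have "{i, i} \<notin> edges (cycle_graph ?n)"
    proof
      assume "{i, i} \<in> edges (cycle_graph ?n)"
      then obtain k where k: "k < ?n" "{i, i} = {k, Suc k mod ?n}" by (auto simp: cycle_graph_def)
      then show False using n by (cases "Suc k = ?n") auto
    qed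
    moreover have "{p ! i, p ! i} \<notin> edges H"
      using assms(2) by (auto simp: simple_graph_def)
    ultimately show ?thesis using equal by (auto simp: induced_def)
  next
    case less
    then show ?thesis using lt ij by blast
  next
    case greater
    then show ?thesis using lt[of j i] ij by (simp add: insert_commute)
  qed
  have "induced H (set p) \<simeq> cycle_graph ?n"
    unfolding graph_iso_def
  proof (intro exI conjI ballI)
    have V: "verts (induced H (set p)) = set p" using assms(3) by (auto simp: induced_def)
    show "bij_betw f (verts (induced H (set p))) (verts (cycle_graph ?n))"
      using fb V by (simp add: cycle_graph_def)
    fix u v assume "u \<in> verts (induced H (set p))" "v \<in> verts (induced H (set p))"
    then obtain i j where "i < ?n" "j < ?n" "u = p ! i" "v = p ! j"
      unfolding V by (metis in_set_conv_nth)
    then show "({u, v} \<in> edges (induced H (set p))) = ({f u, f v} \<in> edges (cycle_graph ?n))"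
      using eq fp by simp
  qed
  then show False using assms(1,3) n unfolding chordal_def by blast
qed

section \<open>Dominating edges with independent non-neighbourhoods\<close>

lemma simple_graph_edgeD:
  "simple_graph G \<Longrightarrow> {x, y} \<in> edges G \<Longrightarrow> x \<in> verts G \<and> y \<in> verts G \<and> x \<noteq> y"
  unfolding simple_graph_def by (metis card_2_iff doubleton_eq_iff insert_subset insert_absorb2)

lemma complement_edge_iff:
  "{x, y} \<in> edges (complement G) \<longleftrightarrow> x \<in> verts G \<and> y \<in> verts G \<and> x \<noteq> y \<and> {x, y} \<notin> edges G"
  unfolding complement_def by (auto simp: doubleton_eq_iff insert_commute)

lemma simple_graph_complement: "simple_graph G \<Longrightarrow> simple_graph (complement G)"
  by (auto simp: simple_graph_def complement_def)

definition dominating_edge :: "'a graph \<Rightarrow> 'a \<Rightarrow> 'a \<Rightarrow> bool" where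
  "dominating_edge G u v \<longleftrightarrow> {u, v} \<in> edges G \<and>
     (\<forall>w\<in>verts G - {u, v}. {u, w} \<in> edges G \<or> {v, w} \<in> edges G)"

lemma dominating_edge_commute: "dominating_edge G u v \<longleftrightarrow> dominating_edge G v u"
  by (auto simp: dominating_edge_def insert_commute)

text \<open>If \<open>u\<close> and \<open>v\<close> were equal, non-adjacent in \<open>G\<close>, or had a common non-neighbour in \<open>G\<close>,
  the complement would contain a path of length at most two between them.\<close>

lemma dominating_edge_if_co_distance:
  assumes "u \<in> verts G" "v \<in> verts G" "distance (complement G) u v \<ge> 3"
  shows "dominating_edge G u v"
proof -
  let ?H = "complement G"
  have V: "verts ?H = verts G" by (simp add: complement_def)
  have far: "3 \<le> length p - 1" if "is_path ?H u p v" for p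
  proof -
    have "distance ?H u v \<le> enat (length p - 1)"
      unfolding distance_def using that by (intro INF_lower) simp
    then have "3 \<le> enat (length p - 1)" using assms(3) by (rule order_trans[rotated])
    then show ?thesis by (simp add: numeral_eq_enat)
  qed
  have ne: "u \<noteq> v" using far[of "[u]"] assms by (auto simp: is_path_def V)
  have "{u, v} \<in> edges G"
    using far[of "[u, v]"] assms ne by (auto simp: is_path_def V complement_edge_iff)
  moreover have "{u, w} \<in> edges G \<or> {v, w} \<in> edges G" if "w \<in> verts G - {u, v}" for w
    using far[of "[u, w, v]"] assms ne that
    by (auto simp: is_path_def V complement_edge_iff insert_commute)
  ultimately show ?thesis by (auto simp: dominating_edge_def)
qed

lemma dominating_edge_exists:
  assumes "co_diameter G \<ge> 3"
  shows "\<exists>u v. dominating_edge G u v"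
proof (rule ccontr)
  assume none: "\<nexists>u v. dominating_edge G u v"
  have *: "distance (complement G) u v \<le> 2" if "u \<in> verts G" "v \<in> verts G" for u v
  proof -
    have "\<not> distance (complement G) u v \<ge> 3"
      using dominating_edge_if_co_distance[OF that] none by blast
    then show ?thesis
      by (cases "distance (complement G) u v") (auto simp: numeral_eq_enat)
  qed
  have "verts (complement G) = verts G" by (simp add: complement_def)
  then have "co_diameter G \<le> 2"
    unfolding co_diameter_def diameter_def by (intro SUP_least *) simp_all
  then have "(3 :: enat) \<le> 2" using assms by (rule order_trans[rotated])
  then show False by simp
qed

text \<open>A vertex \<open>y\<close> of \<open>W\<close> has this property if it is simplicial in the subgraph of the
  complement induced by \<open>W\<close>.\<close>

definition independent_non_neighbours :: "'a graph \<Rightarrow> 'a set \<Rightarrow> 'a \<Rightarrow> bool" where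
  "independent_non_neighbours G W y \<longleftrightarrow>
     (\<forall>a\<in>W - {y}. \<forall>b\<in>W - {y}. {y, a} \<notin> edges G \<and> {y, b} \<notin> edges G \<longrightarrow> {a, b} \<notin> edges G)"

lemma independent_non_neighbours_if_simplicial:
  assumes "simple_graph G" "W \<subseteq> verts G"
    and "simplicial (\<lambda>x y. {x, y} \<in> edges (complement G)) W y"
  shows "independent_non_neighbours G W y"
  unfolding independent_non_neighbours_def
proof (intro ballI impI)
  fix a b assume ab: "a \<in> W - {y}" "b \<in> W - {y}" "{y, a} \<notin> edges G \<and> {y, b} \<notin> edges G"
  show "{a, b} \<notin> edges G"
  proof (cases "a = b")
    case True
    then show ?thesis using assms(1) simple_graph_edgeD by fastforce
  next
    case False
    then show ?thesis using assms ab unfolding simplicial_def complement_edge_iff by blast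
  qed
qed

lemma co_chordal_simplicial:
  assumes "simple_graph G" "co_chordal G" "W \<subseteq> verts G" "W \<noteq> {}"
  shows "\<exists>y\<in>W. independent_non_neighbours G W y"
proof -
  let ?R = "\<lambda>x y. {x, y} \<in> edges (complement G)"
  have "symp ?R"
    by (auto simp: symp_def complement_edge_iff insert_commute)
  moreover have "\<not> induced_cycle ?R p" if "set p \<subseteq> W" for p
    using no_induced_cycle_if_chordal[of "complement G" p] assms that simple_graph_complement
    by (auto simp: co_chordal_def complement_def)
  moreover have "finite W" using assms by (auto simp: simple_graph_def intro: finite_subset)
  ultimately obtain y where "simplicial ?R W y"
    using simplicial_vertex_exists[of ?R W] assms(4) by blast
  then show ?thesis
    using independent_non_neighbours_if_simplicial[OF assms(1,3)] by (auto simp: simplicial_def)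
qed

text \<open>The edge \<open>{u, v}\<close> is dominating iff, in the complement, \<open>v\<close> lies outside the closed
  neighbourhood of the connected set consisting of \<open>u\<close> and its neighbours, and such a
  vertex can be replaced by a simplicial one.\<close>

lemma dominating_edge_end_simplicial:
  assumes "simple_graph G" "co_chordal G" "dominating_edge G u v"
  shows "\<exists>v'. dominating_edge G u v' \<and> independent_non_neighbours G (verts G) v'"
proof -
  let ?R = "\<lambda>x y. {x, y} \<in> edges (complement G)"
  let ?X = "insert u {w. ?R u w}"
  have R: "symp ?R"
    by (auto simp: symp_def complement_edge_iff insert_commute)
  have no: "\<not> induced_cycle ?R p" if "set p \<subseteq> verts G" for p
    using no_induced_cycle_if_chordal[of "complement G" p] assms that simple_graph_complement
    by (auto simp: co_chordal_def complement_def)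
  have uv: "u \<in> verts G" "v \<in> verts G" "u \<noteq> v"
    using simple_graph_edgeD[of G u v] assms unfolding dominating_edge_def by blast+
  have con: "connected_in ?R ?X"
    unfolding connected_in_def
  proof (intro ballI)
    fix x y assume "x \<in> ?X" "y \<in> ?X"
    then have "x = u \<or> (x, u) \<in> steps ?R ?X" "y = u \<or> (u, y) \<in> steps ?R ?X"
      by (auto simp: steps_def insert_commute)
    then have "(x, u) \<in> (steps ?R ?X)\<^sup>*" "(u, y) \<in> (steps ?R ?X)\<^sup>*" by blast+
    then show "(x, y) \<in> (steps ?R ?X)\<^sup>*" by (rule rtrancl_trans)
  qed
  have "\<exists>y\<in>verts G - ?X. (\<forall>x\<in>?X. \<not> ?R x y) \<and> simplicial ?R (verts G) y"
  proof (rule simplicial_vertex_far_from_connected_set[OF R _ no _ _ con])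
    show "finite (verts G)" using assms by (simp add: simple_graph_def)
    show "v \<notin> ?X" "\<forall>x\<in>?X. \<not> ?R x v"
      using assms(3) uv by (auto simp: dominating_edge_def complement_edge_iff insert_commute)
  qed (use uv in \<open>auto simp: complement_edge_iff\<close>)
  then obtain y where y: "y \<in> verts G - ?X" "\<forall>x\<in>?X. \<not> ?R x y" "simplicial ?R (verts G) y"
    by blast
  have "dominating_edge G u y"
    using y uv unfolding dominating_edge_def complement_edge_iff
    by (auto simp: complement_edge_iff insert_commute)
  then show ?thesis
    using independent_non_neighbours_if_simplicial[OF assms(1) _ y(3)] by blast
qed

lemma simplicial_dominating_edge:
  assumes "simple_graph G" "co_chordal G" "co_diameter G \<ge> 3"
  obtains u v where "dominating_edge G u v"
    "independent_non_neighbours G (verts G) u" "independent_non_neighbours G (verts G) v"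
proof -
  obtain u0 v0 where "dominating_edge G u0 v0" using dominating_edge_exists[OF assms(3)] by blast
  then obtain v where v: "dominating_edge G u0 v" "independent_non_neighbours G (verts G) v"
    using dominating_edge_end_simplicial[OF assms(1,2)] by blast
  then have "dominating_edge G v u0" by (simp add: dominating_edge_commute)
  then obtain u where "dominating_edge G v u" "independent_non_neighbours G (verts G) u"
    using dominating_edge_end_simplicial[OF assms(1,2)] by blast
  then show thesis using v(2) by (intro that)
qed

section \<open>Toughness and cut edges\<close>

definition nbrs :: "'a graph \<Rightarrow> 'a \<Rightarrow> 'a set" where
  "nbrs G x = {y \<in> verts G. {x, y} \<in> edges G}"

lemma verts_del_verts: "verts (del_verts G S) = verts G - S"
  by (auto simp: del_verts_def induced_def)

lemma edge_del_verts_iff: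
  "{x, y} \<in> edges (del_verts G S) \<longleftrightarrow> {x, y} \<in> edges G \<and> x \<in> verts G - S \<and> y \<in> verts G - S"
  by (auto simp: del_verts_def induced_def)

lemma separatorI:
  assumes "finite (verts G)" "S \<subseteq> verts G" "x \<in> verts G - S" "y \<in> verts G - S"
    and "\<not> linked (del_verts G S) x y"
  shows "separator G S"
proof -
  have "x \<noteq> y" using assms linked_refl[of x "del_verts G S"] by (auto simp: verts_del_verts)
  moreover have "\<not> linked (del_verts G S) y x" using assms(5) linked_sym by metis
  ultimately have "card {x, y} \<le> num_components (del_verts G S)"
    using assms by (intro num_components_ge) (auto simp: verts_del_verts)
  then show ?thesis using \<open>x \<noteq> y\<close> assms by (simp add: separator_def)
qed

lemma toughness_le:
  assumes "toughness G = ereal t" "separator G S"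
  shows "t * real (num_components (del_verts G S)) \<le> real (card S)"
proof -
  have "toughness G \<le> ereal (real (card S) / real (num_components (del_verts G S)))"
    unfolding toughness_def using assms(2) by (intro INF_lower) simp
  moreover have "num_components (del_verts G S) \<ge> 2" using assms(2) by (simp add: separator_def)
  ultimately show ?thesis using assms(1) by (simp add: pos_le_divide_eq)
qed

lemma toughness_nonneg: "toughness G \<ge> 0"
  unfolding toughness_def by (intro INF_greatest) simp

lemma not_linked_if_isolated:
  assumes "x \<noteq> y" "\<And>z. z \<in> verts G \<Longrightarrow> {x, z} \<notin> edges G"
  shows "\<not> linked G x y"
  using linked_closed[of G x y "{x}"] assms by blast

text \<open>If deleting \<open>T\<close> isolates all vertices of \<open>I\<close> except possibly \<open>r\<close>, then the vertices
  of \<open>I\<close> lie in distinct components.\<close>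

lemma toughness_bound:
  assumes "simple_graph G" "toughness G = ereal t" "T \<subseteq> verts G"
    and I: "I \<subseteq> verts G - T" "2 \<le> card I"
    and iso: "\<And>x y. x \<in> I \<Longrightarrow> x \<noteq> r \<Longrightarrow> y \<in> verts G - T \<Longrightarrow> {x, y} \<notin> edges G"
  shows "t * real (card I) \<le> real (card T)"
proof -
  let ?H = "del_verts G T"
  have fin: "finite (verts G)" using assms(1) by (simp add: simple_graph_def)
  have nl: "\<not> linked ?H x y" if "x \<in> I" "y \<in> I" "x \<noteq> y" for x y
  proof (cases "x = r")
    case False
    then show ?thesis using that iso
      by (intro not_linked_if_isolated) (auto simp: verts_del_verts edge_del_verts_iff)
  next
    case True
    then have "\<not> linked ?H y x" using that iso
      by (intro not_linked_if_isolated) (auto simp: verts_del_verts edge_del_verts_iff)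
    then show ?thesis using linked_sym by metis
  qed
  have c: "card I \<le> num_components ?H"
    using fin I nl by (intro num_components_ge) (auto simp: verts_del_verts)
  then have "separator G T" using assms(3) I by (simp add: separator_def)
  then have "t * real (num_components ?H) \<le> real (card T)" using toughness_le assms(2) by blast
  moreover have "0 \<le> t" using toughness_nonneg[of G] assms(2) by simp
  then have "t * real (card I) \<le> t * real (num_components ?H)"
    using c by (intro mult_left_mono) auto
  ultimately show ?thesis by linarith
qed

lemma toughness_finite:
  assumes "simple_graph G" "\<not> complete G"
  obtains t where "toughness G = ereal t"
proof -
  obtain x y where xy: "x \<in> verts G" "y \<in> verts G" "x \<noteq> y" "{x, y} \<notin> edges G"
    using assms(2) by (auto simp: complete_def)
  let ?S = "verts G - {x, y}"
  have "separator G ?S"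
  proof (rule separatorI[of _ _ x y])
    show "\<not> linked (del_verts G ?S) x y"
      using xy simple_graph_edgeD[OF assms(1), of x x]
      by (intro not_linked_if_isolated) (auto simp: verts_del_verts edge_del_verts_iff)
  qed (use xy assms(1) in \<open>auto simp: simple_graph_def\<close>)
  then have "toughness G \<le> ereal (real (card ?S) / real (num_components (del_verts G ?S)))"
    unfolding toughness_def by (intro INF_lower) simp
  then have "toughness G \<noteq> \<infinity>" by auto
  moreover have "toughness G \<noteq> -\<infinity>" using toughness_nonneg[of G] by auto
  ultimately show thesis using that by (cases "toughness G") auto
qed

section \<open>Minimally tough graphs with a dominating edge\<close>

locale minimally_tough_graph =
  fixes G :: "'a graph" and t :: real
  assumes simple: "simple_graph G"
    and tough: "toughness G = ereal t"
    and minimal: "\<And>e. e \<in> edges G \<Longrightarrow> toughness (del_edge G e) < ereal t"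
begin

abbreviation adj :: "'a \<Rightarrow> 'a \<Rightarrow> bool" (infix "\<sim>" 50) where "x \<sim> y \<equiv> {x, y} \<in> edges G"
abbreviation V :: "'a set" where "V \<equiv> verts G"

lemma finite_V: "finite V" using simple by (simp add: simple_graph_def)

lemma adj_sym: "x \<sim> y \<longleftrightarrow> y \<sim> x" by (simp add: insert_commute)

lemma adjD: assumes "x \<sim> y" shows "x \<in> V" "y \<in> V" "x \<noteq> y"
  using simple_graph_edgeD[OF simple assms] by blast+

lemma not_adj_self: "\<not> x \<sim> x" using adjD by blast

lemma degree_ge:
  assumes "x \<in> V" "y \<in> V" "x \<noteq> y" "\<not> x \<sim> y"
  shows "2 * t \<le> real (card (nbrs G x))"
proof -
  have "t * real (card {x, y}) \<le> real (card (nbrs G x))"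
    by (rule toughness_bound[OF simple tough, where r = y])
      (use assms not_adj_self in \<open>auto simp: nbrs_def\<close>)
  then show ?thesis using assms by simp
qed

text \<open>Deleting a dominating edge \<open>{u, v}\<close> can only lower the toughness through a set \<open>S\<close>
  avoiding \<open>u\<close> and \<open>v\<close>, and since every remaining vertex is adjacent to \<open>u\<close> or \<open>v\<close>, what
  remains of \<open>G - {u, v}\<close> has exactly two components.\<close>

lemma dominating_edge_cut:
  assumes dom: "dominating_edge G u v"
  obtains S where "S \<subseteq> V - {u, v}" "real (card S) < 2 * t"
    "\<And>w. w \<in> V - S \<Longrightarrow> \<not> (u \<sim> w \<and> w \<sim> v)"
    "\<And>x y. x \<in> V - S \<Longrightarrow> y \<in> V - S \<Longrightarrow> x \<noteq> v \<Longrightarrow> y \<noteq> u \<Longrightarrow> \<not> (u \<sim> x \<and> x \<sim> y \<and> y \<sim> v)"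
proof -
  have uv: "u \<sim> v" "u \<in> V" "v \<in> V" "u \<noteq> v" using dom adjD by (auto simp: dominating_edge_def)
  let ?G = "del_edge G {u, v}"
  have "toughness ?G < ereal t" using minimal uv by blast
  then obtain S where S: "separator ?G S"
    "ereal (real (card S) / real (num_components (del_verts ?G S))) < ereal t"
    unfolding toughness_def by (auto simp: INF_less_iff)
  let ?H = "del_verts ?G S"
  let ?c = "num_components ?H"
  have SV: "S \<subseteq> V" and c2: "2 \<le> ?c" using S by (auto simp: separator_def del_edge_def)
  have lt: "real (card S) < t * real ?c" using S c2 by (simp add: pos_divide_less_eq)
  have VH: "verts ?H = V - S" by (simp add: verts_del_verts del_edge_def)
  have EH: "{x, y} \<in> edges ?H \<longleftrightarrow> x \<sim> y \<and> {x, y} \<noteq> {u, v} \<and> x \<in> V - S \<and> y \<in> V - S" for x y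
    unfolding edge_del_verts_iff by (auto simp: del_edge_def)
  have uvS: "u \<notin> S \<and> v \<notin> S"
  proof (rule ccontr)
    \<comment> \<open>Otherwise the deleted edge disappears together with \<open>S\<close>.\<close>
    assume "\<not> (u \<notin> S \<and> v \<notin> S)"
    then have "{e \<in> edges G - {{u, v}}. e \<subseteq> V - S} = {e \<in> edges G. e \<subseteq> V - S}" by auto
    then have eq: "?H = del_verts G S" by (simp add: del_verts_def induced_def del_edge_def)
    then have "separator G S" using SV c2 by (simp add: separator_def)
    then show False using toughness_le[OF tough] lt eq by fastforce
  qed
  have lk: "linked ?H x y" if "{x, y} \<in> edges ?H" for x y
    using that linked_edge[of x y ?H] VH EH by simp
  have near: "linked ?H x u \<or> linked ?H x v" if x: "x \<in> V - S" for x
  proof (cases "x = u \<or> x = v")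
    case True
    then show ?thesis using linked_refl[of x ?H] x VH by auto
  next
    case False
    then have "{x, u} \<in> edges ?H \<or> {x, v} \<in> edges ?H"
      using dom x uv uvS unfolding EH dominating_edge_def by (auto simp: doubleton_eq_iff adj_sym)
    then show ?thesis using lk by blast
  qed
  have nl: "\<not> linked ?H u v"
  proof
    assume "linked ?H u v"
    then have "\<exists>y\<in>{v}. linked ?H x y" if "x \<in> verts ?H" for x
      using near[of x] that VH linked_trans by fastforce
    then have "?c \<le> card {v}" by (intro num_components_le) auto
    then show False using c2 by simp
  qed
  have "?c \<le> card {u, v}" using near VH by (intro num_components_le) auto
  then have "?c = 2" using c2 uv by simp
  have nocommon: "\<not> (u \<sim> w \<and> w \<sim> v)" if w: "w \<in> V - S" for w
  proof
    assume a: "u \<sim> w \<and> w \<sim> v"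
    then have "{u, w} \<in> edges ?H" "{w, v} \<in> edges ?H"
      using w uv uvS adjD[of u w] adjD[of w v] unfolding EH by (auto simp: doubleton_eq_iff)
    then have "linked ?H u w" "linked ?H w v" using lk by blast+
    then show False using nl by (metis linked_trans)
  qed
  have nopath: "\<not> (u \<sim> x \<and> x \<sim> y \<and> y \<sim> v)"
    if xy: "x \<in> V - S" "y \<in> V - S" "x \<noteq> v" "y \<noteq> u" for x y
  proof (rule notI)
    assume a: "u \<sim> x \<and> x \<sim> y \<and> y \<sim> v"
    then have a1: "u \<sim> x" and a2: "x \<sim> y" and a3: "y \<sim> v" by simp_all
    have "x \<noteq> u" "y \<noteq> v" using adjD(3)[OF a1] adjD(3)[OF a3] by simp_all
    then have "{u, x} \<noteq> {u, v}" "{x, y} \<noteq> {u, v}" "{y, v} \<noteq> {u, v}"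
      using xy by (simp_all add: doubleton_eq_iff)
    then have "{u, x} \<in> edges ?H" "{x, y} \<in> edges ?H" "{y, v} \<in> edges ?H"
      using a xy uv uvS unfolding EH by blast+
    then have "linked ?H u x" "linked ?H x y" "linked ?H y v" using lk by blast+
    then show False using nl by (metis linked_trans)
  qed
  have "S \<subseteq> V - {u, v}" "real (card S) < 2 * t" using SV uvS lt \<open>?c = 2\<close> by auto
  then show thesis using nocommon nopath by (rule that)
qed

end

section \<open>Neighbourhood descriptions of the extremal graphs\<close>

definition double_star_shape :: "'a graph \<Rightarrow> 'a \<Rightarrow> 'a \<Rightarrow> 'a set \<Rightarrow> 'a set \<Rightarrow> bool" where
  "double_star_shape G u v A B \<longleftrightarrow>
     verts G = {u, v} \<union> A \<union> B \<and> u \<noteq> v \<and> u \<notin> A \<union> B \<and> v \<notin> A \<union> B \<and> A \<inter> B = {} \<and>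
     nbrs G u = insert v A \<and> nbrs G v = insert u B \<and>
     (\<forall>a\<in>A. nbrs G a = {u}) \<and> (\<forall>b\<in>B. nbrs G b = {v})"

definition bipartite_shape :: "'a graph \<Rightarrow> 'a set \<Rightarrow> 'a set \<Rightarrow> bool" where
  "bipartite_shape G A B \<longleftrightarrow> verts G = A \<union> B \<and> A \<inter> B = {} \<and>
     (\<forall>a\<in>A. nbrs G a = B) \<and> (\<forall>b\<in>B. nbrs G b = A)"

text \<open>Complements of matchings missing at most one vertex: each vertex has at most one
  non-neighbour, and at most one vertex has none.\<close>

definition co_matching_shape :: "'a graph \<Rightarrow> bool" where
  "co_matching_shape G \<longleftrightarrow> 3 \<le> card (verts G) \<and>
     (\<forall>x\<in>verts G. card (verts G) - 2 \<le> card (nbrs G x)) \<and>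
     (\<forall>x\<in>verts G. \<forall>y\<in>verts G. nbrs G x = verts G - {x} \<and> nbrs G y = verts G - {y} \<longrightarrow> x = y)"

text \<open>The double stars include the stars, where \<open>B\<close> is empty, and \<open>P\<^sub>4\<close>, where both sets
  are singletons; \<open>A \<noteq> {}\<close> excludes a single edge.\<close>

definition extremal_shape :: "'a graph \<Rightarrow> bool" where
  "extremal_shape G \<longleftrightarrow>
     (\<exists>u v A B. double_star_shape G u v A B \<and> A \<noteq> {}) \<or>
     (\<exists>A B. bipartite_shape G A B \<and> card A = 2 \<and> card B = 3) \<or>
     co_matching_shape G"

context minimally_tough_graph
begin

lemma adj_iff_nbrs: "x \<sim> y \<longleftrightarrow> y \<in> nbrs G x"
  using adjD by (auto simp: nbrs_def)

lemma finite_nbrs: "finite (nbrs G x)"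
  using finite_V by (simp add: nbrs_def)

text \<open>The separation of \<open>u\<close> from \<open>v\<close> in \<open>G - {u, v} - S\<close> is recorded by the absence of
  paths of length two and three, since around a dominating edge a shortest path from \<open>u\<close>
  to \<open>v\<close> avoiding that edge has at most three edges.\<close>

definition cuts :: "'a \<Rightarrow> 'a \<Rightarrow> 'a set \<Rightarrow> bool" where
  "cuts u v S \<longleftrightarrow> S \<subseteq> V - {u, v} \<and> real (card S) < 2 * t \<and>
    (\<forall>w\<in>V - S. \<not> (u \<sim> w \<and> w \<sim> v)) \<and>
    (\<forall>x\<in>V - S. \<forall>y\<in>V - S. x \<noteq> v \<and> y \<noteq> u \<longrightarrow> \<not> (u \<sim> x \<and> x \<sim> y \<and> y \<sim> v))"

lemma cuts_exists:
  assumes "dominating_edge G u v"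
  obtains S where "cuts u v S"
proof -
  obtain S where "S \<subseteq> V - {u, v}" "real (card S) < 2 * t"
    "\<And>w. w \<in> V - S \<Longrightarrow> \<not> (u \<sim> w \<and> w \<sim> v)"
    "\<And>x y. x \<in> V - S \<Longrightarrow> y \<in> V - S \<Longrightarrow> x \<noteq> v \<Longrightarrow> y \<noteq> u \<Longrightarrow> \<not> (u \<sim> x \<and> x \<sim> y \<and> y \<sim> v)"
    using dominating_edge_cut[OF assms] by metis
  then show thesis by (intro that[of S]) (auto simp: cuts_def)
qed

lemma cuts_commute: "cuts u v S \<longleftrightarrow> cuts v u S"
proof -
  have "cuts v u S" if c: "cuts u v S" for u v S
  proof -
    have "\<not> (v \<sim> w \<and> w \<sim> u)" if "w \<in> V - S" for w
      using c that unfolding cuts_def adj_sym[of v w] adj_sym[of w u] by blast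
    moreover have "\<not> (v \<sim> x \<and> x \<sim> y \<and> y \<sim> u)"
      if "x \<in> V - S" "y \<in> V - S" "x \<noteq> u" "y \<noteq> v" for x y
      using c that unfolding cuts_def adj_sym[of v x] adj_sym[of y u] adj_sym[of x y] by blast
    moreover have "S \<subseteq> V - {v, u} \<and> real (card S) < 2 * t"
      using c unfolding cuts_def by blast
    ultimately show ?thesis unfolding cuts_def by blast
  qed
  then show ?thesis by metis
qed

end

section \<open>Private neighbours of the ends of a dominating edge\<close>

text \<open>The private neighbours of the two ends outside the cut \<open>S\<close> form the sets \<open>A\<close> and \<open>B\<close>
  below. A private neighbour of \<open>u\<close> is a non-neighbour of \<open>v\<close>, so \<open>ind_v\<close> makes \<open>A\<close>
  independent, and \<open>ind_u\<close> does the same for \<open>B\<close>.\<close>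

locale cut_dominating_edge = minimally_tough_graph G t for G :: "'a graph" and t :: real +
  fixes u v :: 'a and S :: "'a set"
  assumes dom: "dominating_edge G u v"
    and ind_u: "independent_non_neighbours G (verts G) u"
    and ind_v: "independent_non_neighbours G (verts G) v"
    and cut: "cuts u v S"
begin

definition A :: "'a set" where "A = nbrs G u - S - {v}"
definition B :: "'a set" where "B = nbrs G v - S - {u}"

lemma uv: "u \<sim> v" "u \<in> V" "v \<in> V" "u \<noteq> v"
  using dom adjD[of u v] unfolding dominating_edge_def by blast+

lemma S: "S \<subseteq> V" "u \<notin> S" "v \<notin> S" "finite S" "real (card S) < 2 * t"
  using cut finite_V by (auto simp: cuts_def intro: finite_subset)

lemma no_common: "w \<in> V - S \<Longrightarrow> u \<sim> w \<Longrightarrow> \<not> v \<sim> w"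
  using cut unfolding cuts_def adj_sym[of v w] by blast

lemma no_path: "x \<in> V - S \<Longrightarrow> y \<in> V - S \<Longrightarrow> x \<noteq> v \<Longrightarrow> y \<noteq> u \<Longrightarrow> u \<sim> x \<Longrightarrow> v \<sim> y \<Longrightarrow> \<not> x \<sim> y"
  using cut unfolding cuts_def adj_sym[of v y] by blast

lemma disj: "u \<notin> A" "v \<notin> A" "u \<notin> B" "v \<notin> B" "A \<inter> B = {}" "A \<inter> S = {}" "B \<inter> S = {}"
  using not_adj_self no_common unfolding A_def B_def nbrs_def by blast+

lemma V_eq: "V = S \<union> {u, v} \<union> A \<union> B"
  using dom uv S by (auto simp: A_def B_def nbrs_def dominating_edge_def)

lemma finite_AB: "finite A" "finite B" using finite_nbrs by (auto simp: A_def B_def)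

lemma card_V: "card V = card S + 2 + card A + card B"
proof -
  have "card (S \<union> {u, v} \<union> A \<union> B) = card (S \<union> {u, v} \<union> A) + card B"
    using disj S finite_AB by (intro card_Un_disjoint) auto
  also have "card (S \<union> {u, v} \<union> A) = card (S \<union> {u, v}) + card A"
    using disj S finite_AB by (intro card_Un_disjoint) auto
  also have "card (S \<union> {u, v}) = card S + card {u, v}"
    using disj S uv by (intro card_Un_disjoint) auto
  finally show ?thesis using V_eq uv by simp
qed

lemma A_adj: "a \<in> A \<Longrightarrow> u \<sim> a \<and> \<not> v \<sim> a \<and> a \<in> V"
  using no_common unfolding A_def nbrs_def by blast

lemma B_adj: "b \<in> B \<Longrightarrow> v \<sim> b \<and> \<not> u \<sim> b \<and> b \<in> V"
  using no_common unfolding B_def nbrs_def by blast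

lemma no_AB: "a \<in> A \<Longrightarrow> b \<in> B \<Longrightarrow> \<not> a \<sim> b"
  using no_path unfolding A_def B_def nbrs_def by blast

lemma A_indep: "a \<in> A \<Longrightarrow> a' \<in> A \<Longrightarrow> \<not> a \<sim> a'"
  using ind_v A_adj[of a] A_adj[of a'] disj(2) unfolding independent_non_neighbours_def by blast

lemma bound_A: assumes "A \<noteq> {}" shows "t * (real (card A) + 1) \<le> real (card S) + 1"
proof -
  have c: "card (insert v A) = Suc (card A)" using finite_AB disj by simp
  have "t * real (card (insert v A)) \<le> real (card (insert u S))"
  proof (rule toughness_bound[OF simple tough, where r = v])
    show "2 \<le> card (insert v A)" using c assms finite_AB by (simp add: card_gt_0_iff Suc_le_eq)
    fix x y assume "x \<in> insert v A" "x \<noteq> v" "y \<in> V - insert u S"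
    then show "\<not> x \<sim> y" using A_adj A_indep no_AB adj_sym V_eq by blast
  qed (use S uv disj V_eq in auto)
  then show ?thesis using c S by (simp add: algebra_simps)
qed

text \<open>Together with \<open>card S < 2 * t\<close> this pins \<open>card S\<close> down as the largest integer below
  \<open>2 * t\<close>; in particular no other dominating edge has a larger cut.\<close>

lemma two_t_le: assumes "A \<noteq> {}" shows "2 * t \<le> real (card S) + 1"
proof -
  have "0 \<le> t" using toughness_nonneg[of G] tough by simp
  moreover have "1 \<le> real (card A)" using assms finite_AB
    by (metis One_nat_def Suc_leI card_gt_0_iff of_nat_1 of_nat_le_iff)
  ultimately have "t * 2 \<le> t * (real (card A) + 1)" by (intro mult_left_mono) auto
  then show ?thesis using bound_A[OF assms] by linarith
qed

lemma degree_gt: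
  assumes "x \<in> V" "y \<in> V" "x \<noteq> y" "\<not> x \<sim> y"
  shows "card S < card (nbrs G x)"
proof -
  have "real (card S) < real (card (nbrs G x))" using degree_ge[OF assms] S by linarith
  then show ?thesis by simp
qed

lemma other_cut_small:
  assumes "A \<noteq> {}" "cuts x y S'"
  shows "card S' \<le> card S"
proof -
  have "real (card S') < real (card S) + 1" using assms two_t_le by (auto simp: cuts_def)
  then show ?thesis by linarith
qed

text \<open>Two dominating vertices span a dominating edge all of whose remaining vertices are
  common neighbours, which makes its cut too large.\<close>

lemma dominating_vertices_unique:
  assumes "A \<noteq> {}" "card B = 0" "card A = 1"
    and "x \<in> V" "y \<in> V" "nbrs G x = V - {x}" "nbrs G y = V - {y}"
  shows "x = y"
proof (rule ccontr)
  assume ne: "x \<noteq> y"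
  have "dominating_edge G x y"
    using assms ne by (auto simp: dominating_edge_def adj_iff_nbrs)
  then obtain S' where S': "cuts x y S'" using cuts_exists by blast
  have "V - {x, y} \<subseteq> S'"
  proof
    fix w assume w: "w \<in> V - {x, y}"
    then have "x \<sim> w" "y \<sim> w" using assms by (auto simp: adj_iff_nbrs)
    then show "w \<in> S'" using S' w unfolding cuts_def adj_sym[of y w] by blast
  qed
  then have "card (V - {x, y}) \<le> card S'" using S' finite_V
    by (intro card_mono) (auto simp: cuts_def intro: finite_subset)
  also have "\<dots> \<le> card S" using other_cut_small assms(1) S' by blast
  finally have "card V - 2 \<le> card S" using assms ne finite_V by (simp add: card_Diff_subset)
  then show False using card_V assms by simp
qed

lemma cut_size_cases:
  fixes a s :: nat
  assumes "real s < 2 * t" "t * (real a + 1) \<le> real s + 1" "1 \<le> a"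
  shows "s = 0 \<or> a = 1 \<or> s = 1 \<and> a = 2"
proof (rule ccontr)
  assume n: "\<not> ?thesis"
  have "real s * (real a + 1) < 2 * t * (real a + 1)"
    using assms(1) by (intro mult_strict_right_mono) auto
  also have "\<dots> \<le> 2 * (real s + 1)" using assms(2) by simp
  finally have "real (s * (a + 1)) < real (2 * s + 2)" by (simp add: algebra_simps)
  then have lt: "s * (a + 1) < 2 * s + 2" by (simp only: of_nat_less_iff)
  have "s * 3 \<le> s * (a + 1)" using n assms(3) by (intro mult_left_mono) auto
  then have "s = 1" using lt n by linarith
  then show False using lt n assms(3) by simp
qed

text \<open>If only \<open>u\<close> has private neighbours, then \<open>v\<close> has exactly the neighbours \<open>S \<union> {u}\<close>
  and the bound for \<open>S \<union> {u}\<close> leaves few sizes for \<open>A\<close> and \<open>S\<close>.\<close>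

lemma one_sided:
  assumes A: "A \<noteq> {}" and B: "B = {}"
  shows "extremal_shape G"
proof -
  obtain p where p: "p \<in> A" using A by blast
  have Vuv: "V = S \<union> {u, v} \<union> A" using V_eq B by simp
  have Nv: "nbrs G v = insert u S"
  proof (rule card_seteq[symmetric, THEN sym])
    show sub: "nbrs G v \<subseteq> insert u S" using B by (auto simp: B_def)
    have "v \<noteq> p" using p disj by blast
    then have "card S < card (nbrs G v)" using degree_gt[of v p] p A_adj uv by blast
    then show "card (insert u S) \<le> card (nbrs G v)" using S by simp
  qed (use S in auto)
  have "1 \<le> card A" using A finite_AB by (simp add: card_gt_0_iff Suc_le_eq)
  then consider "card S = 0" | "card A = 1" | "card S = 1" "card A = 2"
    using cut_size_cases[OF S(5) bound_A[OF A]] by metis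
  then show ?thesis
  proof cases
    case 1
    then have S0: "x \<notin> S" for x using S by simp
    have V0: "V = {u, v} \<union> A" using Vuv S0 by blast
    have Nu: "nbrs G u = insert v A" using S0 uv by (auto simp: A_def nbrs_def)
    have NA: "nbrs G a = {u}" if a: "a \<in> A" for a
    proof -
      have "y \<in> nbrs G a \<longleftrightarrow> y = u" for y
        using A_adj[OF a] A_indep[OF a] V0 uv adj_sym[of a] by (auto simp: nbrs_def)
      then show ?thesis by blast
    qed
    have "nbrs G v = {u}" using Nv S0 by blast
    then have "double_star_shape G u v A {}"
      unfolding double_star_shape_def using V0 disj(1,2) uv(4) Nu NA by simp
    then show ?thesis using A unfolding extremal_shape_def by blast
  next
    case 2
    \<comment> \<open>Every degree is at least \<open>card S + 1\<close>, which is two less than the number of vertices.\<close>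
    have c: "card V = card S + 3" using card_V 2 B by simp
    have "co_matching_shape G"
      unfolding co_matching_shape_def
    proof (intro conjI ballI impI)
      show "3 \<le> card V" using c by simp
      show "card V - 2 \<le> card (nbrs G x)" if x: "x \<in> V" for x
      proof (cases "\<exists>y\<in>V. x \<noteq> y \<and> \<not> x \<sim> y")
        case True
        then show ?thesis using degree_gt x c by force
      next
        case False
        then have "nbrs G x = V - {x}" using not_adj_self by (auto simp: nbrs_def)
        then show ?thesis using x finite_V by simp
      qed
      show "x = y" if "x \<in> V" "y \<in> V" "nbrs G x = V - {x} \<and> nbrs G y = V - {y}" for x y
        using dominating_vertices_unique[of x y] that A B 2 by simp
    qed
    then show ?thesis unfolding extremal_shape_def by blast
  next
    case 3
    obtain w where "S = {w}" using 3 by (auto simp: card_Suc_eq numeral_eq_Suc)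
    then have w: "x \<in> S \<longleftrightarrow> x = w" for x by blast
    have Vw: "V = {w, u, v} \<union> A" using Vuv w by blast
    have wne: "w \<noteq> u" "w \<noteq> v" "w \<notin> A" using w S disj by blast+
    have Nv: "nbrs G v = {u, w}" using Nv w by blast
    have NA: "nbrs G a = {u, w}" if a: "a \<in> A" for a
    proof (rule card_seteq)
      show "nbrs G a \<subseteq> {u, w}"
        using A_adj[OF a] A_indep[OF a] Vw adj_sym[of a] by (auto simp: nbrs_def)
      have "a \<noteq> v" using a disj by blast
      then have "card S < card (nbrs G a)"
        using degree_gt[of a v] A_adj[OF a] uv unfolding adj_sym[of a v] by blast
      then show "card {u, w} \<le> card (nbrs G a)" using 3 wne by simp
    qed simp
    have "v \<sim> w" "a \<in> A \<Longrightarrow> a \<sim> w" for a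
      using Nv NA by (auto simp: adj_iff_nbrs)
    then have wadj: "w \<sim> v" "a \<in> A \<Longrightarrow> w \<sim> a" for a
      by (auto simp: insert_commute)
    \<comment> \<open>Otherwise \<open>{w, u}\<close> is dominating with three common neighbours, and \<open>card S = 1\<close>.\<close>
    have "\<not> w \<sim> u"
    proof
      assume wu: "w \<sim> u"
      have "dominating_edge G w u"
        using wu wadj Vw by (auto simp: dominating_edge_def)
      then obtain S' where S': "cuts w u S'" using cuts_exists by blast
      have "insert v A \<subseteq> S'"
        using S' wadj uv A_adj adj_sym[of v u] adj_sym[of _ u] unfolding cuts_def by blast
      then have "card (insert v A) \<le> card S'" using S' finite_V
        by (intro card_mono) (auto simp: cuts_def intro: finite_subset)
      then show False using other_cut_small[OF A S'] 3 disj finite_AB by simp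
    qed
    have Nu: "nbrs G u = insert v A"
      using \<open>\<not> w \<sim> u\<close> uv A_adj Vw adj_sym[of u w] not_adj_self[of u]
      by (auto simp: nbrs_def)
    have Nw: "nbrs G w = insert v A"
      using \<open>\<not> w \<sim> u\<close> wadj Vw not_adj_self[of w] by (auto simp: nbrs_def)
    have "bipartite_shape G {u, w} (insert v A)"
      unfolding bipartite_shape_def using Vw wne uv(4) disj(1,2) Nu Nw Nv NA by auto
    moreover have "card {u, w} = 2" "card (insert v A) = 3" using wne 3 disj finite_AB by auto
    ultimately show ?thesis unfolding extremal_shape_def by blast
  qed
qed

end

context cut_dominating_edge
begin

lemma swap: "cut_dominating_edge G t v u S"
  using dom ind_u ind_v cut
  by unfold_locales (simp_all add: dominating_edge_commute cuts_commute)

lemma A_swap: "cut_dominating_edge.A G v u S = B"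
  using cut_dominating_edge.A_def[OF swap] by (simp add: B_def)

text \<open>The inclusion from left to right is clear from the structure outside \<open>S\<close>; equality is
  forced by the degree bound.\<close>

lemma nbrs_of_private_nbr:
  assumes "a \<in> A"
  shows "nbrs G a = insert u S"
proof (rule card_seteq)
  show "nbrs G a \<subseteq> insert u S"
  proof
    fix x assume "x \<in> nbrs G a"
    then have x: "a \<sim> x" "x \<in> V" by (auto simp: nbrs_def)
    then show "x \<in> insert u S"
      using V_eq A_indep[OF assms] no_AB[OF assms] A_adj[OF assms] adj_sym[of a v] by blast
  qed
  have "a \<noteq> v" using assms disj by blast
  then have "card S < card (nbrs G a)"
    using degree_gt[of a v] A_adj[OF assms] uv unfolding adj_sym[of a v] by blast
  then show "card (insert u S) \<le> card (nbrs G a)" using S by simp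
qed (use S in simp)

lemma cut_adj_A: "a \<in> A \<Longrightarrow> w \<in> S \<Longrightarrow> a \<sim> w"
  using nbrs_of_private_nbr adj_iff_nbrs by blast

text \<open>A vertex of \<open>S\<close> that misses \<open>v\<close> would be adjacent to another non-neighbour of \<open>v\<close>,
  namely to any vertex of \<open>A\<close>.\<close>

lemma cut_adj_v:
  assumes "A \<noteq> {}" "w \<in> S"
  shows "v \<sim> w"
proof (rule ccontr)
  assume n: "\<not> v \<sim> w"
  obtain a where a: "a \<in> A" using assms by blast
  have "w \<in> V - {v}" "a \<in> V - {v}" using assms a S disj A_adj by blast+
  then show False
    using ind_v n A_adj[OF a] cut_adj_A[OF a assms(2)] unfolding independent_non_neighbours_def by blast
qed

text \<open>If both ends have private neighbours and \<open>S\<close> is empty, the graph is a double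
  star. Otherwise take \<open>w \<in> S\<close> whose set \<open>D\<close> of non-neighbours in \<open>S\<close> is independent. It is
  joined to everything outside \<open>S\<close>, so \<open>{w, u}\<close> is dominating as well, and its cut
  \<open>S'\<close> is no larger than \<open>S\<close>. As \<open>S'\<close> contains the common neighbours of \<open>w\<close> and \<open>u\<close>,
  this forces \<open>card A \<le> card D\<close>. The bound for the complement of \<open>D \<union> {w}\<close> then leaves
  only the case of a single \<open>x\<close> in \<open>D\<close>; there \<open>S'\<close> has to miss \<open>x\<close> and the private
  neighbour \<open>q\<close> of \<open>v\<close>, although \<open>u\<close>, \<open>x\<close>, \<open>q\<close>, \<open>w\<close> is a path.\<close>

lemma two_sided:
  assumes A: "A \<noteq> {}" and B: "B \<noteq> {}"
    and simpl: "\<And>W. W \<subseteq> V \<Longrightarrow> W \<noteq> {} \<Longrightarrow> \<exists>y\<in>W. independent_non_neighbours G W y"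
  shows "extremal_shape G"
proof (cases "S = {}")
  case True
  then have S0: "x \<notin> S" for x by simp
  have V0: "V = {u, v} \<union> A \<union> B" using V_eq S0 by blast
  have Nu: "nbrs G u = insert v A" using S0 uv by (auto simp: A_def nbrs_def)
  have Nv: "nbrs G v = insert u B" using S0 uv adj_sym[of v u] by (auto simp: B_def nbrs_def)
  have NA: "nbrs G a = {u}" if "a \<in> A" for a
    using nbrs_of_private_nbr[OF that] S0 by blast
  have NB: "nbrs G b = {v}" if "b \<in> B" for b
    using cut_dominating_edge.nbrs_of_private_nbr[OF swap, unfolded A_swap, OF that] S0 by blast
  have "double_star_shape G u v A B"
    unfolding double_star_shape_def using V0 uv disj Nu Nv NA NB by auto
  then show ?thesis using A unfolding extremal_shape_def by blast
next
  case False
  obtain w where w: "w \<in> S" "independent_non_neighbours G S w"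
    using simpl[of S] S(1) False by blast
  define D where "D = {x \<in> S - {w}. \<not> w \<sim> x}"
  have finD: "finite D" "D \<subseteq> S" "w \<notin> D" using S by (auto simp: D_def)
  have Sv: "v \<sim> x" if "x \<in> S" for x using cut_adj_v[OF A that] .
  have Su: "u \<sim> x" if "x \<in> S" for x
    using cut_dominating_edge.cut_adj_v[OF swap, unfolded A_swap, OF B that] .
  have SA: "x \<sim> a" if "x \<in> S" "a \<in> A" for x a
    using cut_adj_A[OF that(2,1)] adj_sym by blast
  have SB: "x \<sim> b" if "x \<in> S" "b \<in> B" for x b
    using cut_dominating_edge.cut_adj_A[OF swap, unfolded A_swap, OF that(2,1)] adj_sym by blast
  have nonw: "x \<in> D" if "x \<in> V" "x \<noteq> w" "\<not> w \<sim> x" for x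
    using that V_eq Su[OF w(1)] Sv[OF w(1)] SA[OF w(1)] SB[OF w(1)] adj_sym[of w u] adj_sym[of w v]
    unfolding D_def by blast
  have wV: "w \<in> V" "w \<noteq> u" "w \<noteq> v" using w S by blast+
  have wu: "w \<sim> u" "w \<sim> v" using Su[OF w(1)] Sv[OF w(1)] adj_sym by blast+
  have "dominating_edge G w u"
    unfolding dominating_edge_def using wu nonw Su finD by blast
  then obtain S' where S': "cuts w u S'" using cuts_exists by blast
  then have S'V: "S' \<subseteq> V - {w, u}" "finite S'"
    using finite_V by (auto simp: cuts_def intro: finite_subset)
  have le: "card S' \<le> card S" using other_cut_small[OF A S'] .
  have common: "x \<in> S'" if "w \<sim> x" "u \<sim> x" for x
    using S' that adjD(2)[OF that(1)] adj_sym[of x u] unfolding cuts_def by blast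
  let ?K = "insert v A \<union> (S - insert w D)"
  \<comment> \<open>The set \<open>?K\<close> collects the common neighbours of \<open>w\<close> and \<open>u\<close>.\<close>
  have "?K \<subseteq> S'"
    using common wu uv(1) SA[OF w(1)] A_adj Su unfolding D_def by blast
  then have "card ?K \<le> card S'" using S'V by (intro card_mono)
  moreover have "card ?K = Suc (card A) + (card S - Suc (card D))"
  proof -
    have "card ?K = card (insert v A) + card (S - insert w D)"
      using finite_AB S disj by (intro card_Un_disjoint) auto
    then show ?thesis using finite_AB disj finD w(1) S by (simp add: card_Diff_subset)
  qed
  moreover have sD: "Suc (card D) \<le> card S"
  proof -
    have "card (insert w D) \<le> card S" using finD w(1) S by (intro card_mono) auto
    then show ?thesis using finD by simp
  qed
  ultimately have DA: "card A \<le> card D" using le by linarith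
  have posA: "1 \<le> card A" and posB: "1 \<le> card B"
    using A B finite_AB by (simp_all add: card_gt_0_iff Suc_le_eq)
  have a1: "card A = 1"
    using cut_size_cases[OF S(5) bound_A[OF A] posA] DA sD posA by auto
  have "t * (real (card B) + 1) \<le> real (card S) + 1"
    using cut_dominating_edge.bound_A[OF swap, unfolded A_swap, OF B] .
  then have b1: "card B = 1"
    using cut_size_cases[OF S(5) _ posB] DA sD posA by auto
  have n: "card V = card S + 4" using card_V a1 b1 by simp
  have Dindep: "\<not> x \<sim> y" if "x \<in> insert w D" "y \<in> insert w D" for x y
    using that w(2) adj_sym[of _ w] not_adj_self
    unfolding independent_non_neighbours_def D_def by blast
  have "t * real (card (insert w D)) \<le> real (card (V - insert w D))"
  proof (rule toughness_bound[OF simple tough])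
    show "insert w D \<subseteq> V - (V - insert w D)" using finD S wV by blast
    show "2 \<le> card (insert w D)" using finD DA a1 by simp
    show "\<And>x y. x \<in> insert w D \<Longrightarrow> x \<noteq> w \<Longrightarrow> y \<in> V - (V - insert w D) \<Longrightarrow> \<not> x \<sim> y"
      using Dindep by blast
  qed auto
  moreover have "card (V - insert w D) = card S + 3 - card D"
    using finD S wV n by (subst card_Diff_subset) auto
  ultimately have tD: "t * (real (card D) + 1) \<le> real (card S) + 3 - real (card D)"
    using finD sD by (simp add: of_nat_diff algebra_simps)
  have d1: "card D = 1"
  proof (rule ccontr)
    assume "card D \<noteq> 1"
    then have d2: "2 \<le> real (card D)" using DA a1 by simp
    have "real (card S) * (real (card D) + 1) < 2 * t * (real (card D) + 1)"
      using S(5) by (intro mult_strict_right_mono) auto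
    also have "\<dots> = 2 * (t * (real (card D) + 1))" by simp
    also have "\<dots> \<le> 2 * (real (card S) + 3 - real (card D))"
      using tD by (intro mult_left_mono) auto
    finally have lt: "real (card S) * (real (card D) + 1) < 2 * (real (card S) + 3 - real (card D))" .
    have "real (card S) * 3 \<le> real (card S) * (real (card D) + 1)"
      using d2 by (intro mult_left_mono) auto
    from le_less_trans[OF this lt] have "real (card S) < 6 - 2 * real (card D)" by simp
    moreover have "real (card D) + 1 \<le> real (card S)" using sD by linarith
    ultimately show False using d2 by linarith
  qed
  obtain x where x: "D = {x}" using d1 by (auto simp: card_Suc_eq)
  obtain q where q: "q \<in> B" using B by blast
  have xS: "x \<in> S" "x \<noteq> w" "\<not> w \<sim> x" using x unfolding D_def by blast+
  \<comment> \<open>The set \<open>?K\<close> already has \<open>card S\<close> elements, so \<open>S'\<close> contains nothing else.\<close>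
  have miss: "y \<notin> S'" if "y \<in> {x, q}" for y
  proof
    assume yS': "y \<in> S'"
    have ne: "x \<noteq> q" "q \<noteq> v" "q \<notin> A" "q \<notin> S" using q xS disj by blast+
    have "insert y ?K \<subseteq> S'" using yS' \<open>?K \<subseteq> S'\<close> by blast
    then have "card (insert y ?K) \<le> card S'" using S'V by (intro card_mono)
    moreover have "y \<notin> ?K" using that ne x xS disj S by blast
    then have "card (insert y ?K) = Suc (card ?K)" using S finite_AB by simp
    ultimately show False
      using \<open>card ?K = _\<close> a1 d1 le sD by linarith
  qed
  have "q \<in> V - S'" "x \<in> V - S'" using miss B_adj[OF q] S xS by blast+
  moreover have "w \<sim> q" "q \<sim> x" "x \<sim> u"
    using SB[OF w(1) q] SB[OF xS(1) q] Su[OF xS(1)] adj_sym by blast+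
  moreover have "q \<noteq> u" "x \<noteq> w" using q disj xS by blast+
  ultimately have False using S' unfolding cuts_def by blast
  then show ?thesis ..
qed

lemma not_complete_private_nbrs:
  assumes "\<not> complete G"
  shows "A \<noteq> {} \<or> B \<noteq> {}"
proof (rule ccontr)
  \<comment> \<open>Then \<open>G\<close> has \<open>card S + 2\<close> vertices, too few for a vertex with a
    non-neighbour, since its degree exceeds \<open>card S\<close>.\<close>
  assume "\<not> (A \<noteq> {} \<or> B \<noteq> {})"
  then have n: "card V = card S + 2" using card_V by simp
  obtain x y where xy: "x \<in> V" "y \<in> V" "x \<noteq> y" "\<not> x \<sim> y"
    using assms by (auto simp: complete_def)
  then have "card S < card (nbrs G x)" by (rule degree_gt)
  moreover have "card (nbrs G x) \<le> card (V - {x, y})"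
    using xy not_adj_self[of x] finite_V by (intro card_mono) (auto simp: nbrs_def)
  moreover have "card (V - {x, y}) = card V - 2" using xy finite_V by (simp add: card_Diff_subset)
  ultimately show False using n by simp
qed

end

lemma (in minimally_tough_graph) extremal_shape_if_co_chordal:
  assumes "co_chordal G" "co_diameter G \<ge> 3" "\<not> complete G"
  shows "extremal_shape G"
proof -
  obtain u v where uv: "dominating_edge G u v"
    "independent_non_neighbours G (verts G) u" "independent_non_neighbours G (verts G) v"
    using simplicial_dominating_edge[OF simple assms(1,2)] .
  obtain S where S: "cuts u v S" using cuts_exists[OF uv(1)] .
  interpret E: cut_dominating_edge G t u v S by unfold_locales (use uv S in auto)
  interpret F: cut_dominating_edge G t v u S by (rule E.swap)
  consider "E.A \<noteq> {}" "E.B \<noteq> {}" | "E.A \<noteq> {}" "E.B = {}" | "E.B \<noteq> {}" "E.A = {}"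
    using E.not_complete_private_nbrs[OF assms(3)] by blast
  then show ?thesis
  proof cases
    case 1
    then show ?thesis using E.two_sided co_chordal_simplicial[OF simple assms(1)] by blast
  next
    case 2
    then show ?thesis by (rule E.one_sided)
  next
    case 3
    have "F.A = E.B" "F.B = E.A" by (auto simp: F.A_def F.B_def E.A_def E.B_def)
    then show ?thesis using F.one_sided 3 by simp
  qed
qed

section \<open>The shapes determine the graphs\<close>

lemma graph_iso_if_nbrs:
  assumes bij: "bij_betw f (verts G) (verts F)"
    and nb: "\<And>x. x \<in> verts G \<Longrightarrow> f ` nbrs G x = nbrs F (f x)"
  shows "G \<simeq> F"
  unfolding graph_iso_def
proof (intro exI conjI ballI)
  show "bij_betw f (verts G) (verts F)" by (rule bij)
  fix x y assume xy: "x \<in> verts G" "y \<in> verts G"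
  have inj: "inj_on f (verts G)" and im: "f ` verts G = verts F"
    using bij by (auto simp: bij_betw_def)
  have "{x, y} \<in> edges G \<longleftrightarrow> y \<in> nbrs G x" using xy by (simp add: nbrs_def)
  also have "\<dots> \<longleftrightarrow> f y \<in> f ` nbrs G x"
    using inj xy by (subst inj_on_image_mem_iff) (auto simp: nbrs_def)
  also have "\<dots> \<longleftrightarrow> {f x, f y} \<in> edges F" using nb xy im by (auto simp: nbrs_def)
  finally show "({x, y} \<in> edges G) = ({f x, f y} \<in> edges F)" .
qed

lemma graph_isoE:
  assumes "G \<simeq> F"
  obtains g where "bij_betw g (verts F) (verts G)"
    "\<And>i. i \<in> verts F \<Longrightarrow> nbrs G (g i) = g ` nbrs F i"
proof -
  obtain f where f: "bij_betw f (verts G) (verts F)"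
    and e: "\<And>x y. x \<in> verts G \<Longrightarrow> y \<in> verts G \<Longrightarrow> {x, y} \<in> edges G \<longleftrightarrow> {f x, f y} \<in> edges F"
    using assms by (auto simp: graph_iso_def)
  let ?g = "the_inv_into (verts G) f"
  have g: "bij_betw ?g (verts F) (verts G)" by (rule bij_betw_the_inv_into[OF f])
  have gV: "?g i \<in> verts G" if "i \<in> verts F" for i using bij_betwE[OF g] that by blast
  have fg: "f (?g i) = i" if "i \<in> verts F" for i
    using f that by (intro f_the_inv_into_f) (auto simp: bij_betw_def)
  have gf: "?g (f x) = x" if "x \<in> verts G" for x
    using f that by (intro the_inv_into_f_f) (auto simp: bij_betw_def)
  have fV: "f x \<in> verts F" if "x \<in> verts G" for x using bij_betwE[OF f] that by blast
  show thesis
  proof (rule that[OF g])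
    fix i assume i: "i \<in> verts F"
    show "nbrs G (?g i) = ?g ` nbrs F i"
    proof (intro set_eqI iffI)
      fix y assume "y \<in> nbrs G (?g i)"
      then have y: "y \<in> verts G" "{?g i, y} \<in> edges G" by (auto simp: nbrs_def)
      then have "f y \<in> nbrs F i" using e[OF gV[OF i] y(1)] fg[OF i] fV by (auto simp: nbrs_def)
      then show "y \<in> ?g ` nbrs F i" using gf[OF y(1)] by (metis imageI)
    next
      fix y assume "y \<in> ?g ` nbrs F i"
      then obtain j where j: "j \<in> verts F" "{i, j} \<in> edges F" "y = ?g j" by (auto simp: nbrs_def)
      then show "y \<in> nbrs G (?g i)" using e[OF gV[OF i] gV[OF j(1)]] fg i gV by (auto simp: nbrs_def)
    qed
  qed
qed

lemma double_star_shape_image: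
  assumes sh: "double_star_shape F u v A B" and g: "bij_betw g (verts F) (verts G)"
    and nb: "\<And>i. i \<in> verts F \<Longrightarrow> nbrs G (g i) = g ` nbrs F i"
  shows "double_star_shape G (g u) (g v) (g ` A) (g ` B)"
proof -
  have VF: "verts F = {u, v} \<union> A \<union> B" "u \<noteq> v" "u \<notin> A \<union> B" "v \<notin> A \<union> B" "A \<inter> B = {}"
    and nF: "nbrs F u = insert v A" "nbrs F v = insert u B"
      "\<And>a. a \<in> A \<Longrightarrow> nbrs F a = {u}" "\<And>b. b \<in> B \<Longrightarrow> nbrs F b = {v}"
    using sh by (auto simp: double_star_shape_def)
  have inj: "inj_on g ({u, v} \<union> A \<union> B)" and im: "verts G = g ` ({u, v} \<union> A \<union> B)"
    using g VF(1) by (auto simp: bij_betw_def)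
  have d: "g u \<noteq> g v" "g u \<notin> g ` A \<union> g ` B" "g v \<notin> g ` A \<union> g ` B"
    using inj VF(2-) by (auto simp: inj_on_def)
  have dAB: "g ` A \<inter> g ` B = {}"
    using inj_on_image_Int[OF inj, of A B] VF(5) by auto
  have "nbrs G (g u) = insert (g v) (g ` A)" "nbrs G (g v) = insert (g u) (g ` B)"
    "\<forall>a\<in>g ` A. nbrs G a = {g u}" "\<forall>b\<in>g ` B. nbrs G b = {g v}"
    using nb nF VF(1) by auto
  then show ?thesis unfolding double_star_shape_def using im d dAB by (simp add: image_Un)
qed

lemma bipartite_shape_image:
  assumes sh: "bipartite_shape F A B" and g: "bij_betw g (verts F) (verts G)"
    and nb: "\<And>i. i \<in> verts F \<Longrightarrow> nbrs G (g i) = g ` nbrs F i"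
  shows "bipartite_shape G (g ` A) (g ` B)"
proof -
  have VF: "verts F = A \<union> B" "A \<inter> B = {}"
    and nF: "\<And>a. a \<in> A \<Longrightarrow> nbrs F a = B" "\<And>b. b \<in> B \<Longrightarrow> nbrs F b = A"
    using sh by (auto simp: bipartite_shape_def)
  have inj: "inj_on g (A \<union> B)" and im: "verts G = g ` (A \<union> B)"
    using g VF(1) by (auto simp: bij_betw_def)
  have "g ` A \<inter> g ` B = {}" using inj_on_image_Int[OF inj, of A B] VF(2) by auto
  moreover have "\<forall>a\<in>g ` A. nbrs G a = g ` B" "\<forall>b\<in>g ` B. nbrs G b = g ` A"
    using nb nF VF(1) by auto
  ultimately show ?thesis unfolding bipartite_shape_def using im by (simp add: image_Un)
qed

lemma co_matching_shape_image:
  assumes sh: "co_matching_shape F" and g: "bij_betw g (verts F) (verts G)"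
    and nb: "\<And>i. i \<in> verts F \<Longrightarrow> nbrs G (g i) = g ` nbrs F i"
  shows "co_matching_shape G"
proof -
  have inj: "inj_on g (verts F)" and im: "verts G = g ` verts F"
    using g by (auto simp: bij_betw_def)
  have c: "card (verts G) = card (verts F)" using bij_betw_same_card[OF g] by simp
  have sub: "nbrs F i \<subseteq> verts F" for i by (auto simp: nbrs_def)
  have cn: "card (nbrs G (g i)) = card (nbrs F i)" if "i \<in> verts F" for i
    using nb[OF that] inj sub by (metis card_image inj_on_subset)
  have full: "nbrs F i = verts F - {i}" if "i \<in> verts F" "nbrs G (g i) = verts G - {g i}" for i
  proof -
    have "g ` nbrs F i = g ` (verts F - {i})"
      using that nb[OF that(1)] im inj by (simp add: inj_on_image_set_diff)
    then show ?thesis using inj sub by (metis Diff_subset inj_on_image_eq_iff)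
  qed
  show ?thesis
    unfolding co_matching_shape_def
  proof (intro conjI ballI impI)
    show "3 \<le> card (verts G)" using sh c by (simp add: co_matching_shape_def)
    fix x assume "x \<in> verts G"
    then show "card (verts G) - 2 \<le> card (nbrs G x)"
      using sh cn c im by (auto simp: co_matching_shape_def)
  next
    fix x y assume xy: "x \<in> verts G" "y \<in> verts G"
      "nbrs G x = verts G - {x} \<and> nbrs G y = verts G - {y}"
    obtain i where i: "i \<in> verts F" "x = g i" using im xy(1) by (metis imageE)
    obtain j where j: "j \<in> verts F" "y = g j" using im xy(2) by (metis imageE)
    have "nbrs F i = verts F - {i}" "nbrs F j = verts F - {j}"
      using full[OF i(1)] full[OF j(1)] xy(3) i(2) j(2) by simp_all
    then have "i = j" using sh i(1) j(1) unfolding co_matching_shape_def by blast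
    then show "x = y" using i j by simp
  qed
qed

lemma double_star_shape_iso:
  assumes G: "double_star_shape G u v A B" and F: "double_star_shape F u' v' A' B'"
    and fin: "finite A" "finite B" "finite A'" "finite B'" and c: "card A = card A'" "card B = card B'"
  shows "G \<simeq> F"
proof -
  obtain \<alpha> \<beta> where \<alpha>: "bij_betw \<alpha> A A'" and \<beta>: "bij_betw \<beta> B B'"
    using fin c finite_same_card_bij by metis
  define f where "f x = (if x = u then u' else if x = v then v' else if x \<in> A then \<alpha> x else \<beta> x)" for x
  have VG: "verts G = {u} \<union> {v} \<union> A \<union> B" "u \<noteq> v" "u \<notin> A \<union> B" "v \<notin> A \<union> B" "A \<inter> B = {}"
    and nG: "nbrs G u = insert v A" "nbrs G v = insert u B"
      "\<And>a. a \<in> A \<Longrightarrow> nbrs G a = {u}" "\<And>b. b \<in> B \<Longrightarrow> nbrs G b = {v}"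
    using G by (auto simp: double_star_shape_def)
  have VF: "verts F = {u'} \<union> {v'} \<union> A' \<union> B'" "u' \<noteq> v'" "u' \<notin> A' \<union> B'" "v' \<notin> A' \<union> B'" "A' \<inter> B' = {}"
    and nF: "nbrs F u' = insert v' A'" "nbrs F v' = insert u' B'"
      "\<And>a. a \<in> A' \<Longrightarrow> nbrs F a = {u'}" "\<And>b. b \<in> B' \<Longrightarrow> nbrs F b = {v'}"
    using F by (auto simp: double_star_shape_def)
  have fu: "f u = u'" "f v = v'" using VG by (auto simp: f_def)
  have fA: "f a = \<alpha> a" "f a \<in> A'" if "a \<in> A" for a
    using that VG \<alpha> by (auto simp: f_def bij_betw_def)
  have fB: "f b = \<beta> b" "f b \<in> B'" if "b \<in> B" for b
    using that VG \<beta> by (auto simp: f_def bij_betw_def)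
  have bA: "bij_betw f A A'" using \<alpha> fA(1) by (simp cong: bij_betw_cong)
  have bB: "bij_betw f B B'" using \<beta> fB(1) by (simp cong: bij_betw_cong)
  have "bij_betw f (verts G) (verts F)"
    unfolding VG(1) VF(1)
    by (intro bij_betw_combine bA bB) (use fu VF(2-) in \<open>auto simp: bij_betw_def\<close>)
  then show ?thesis
  proof (rule graph_iso_if_nbrs)
    have imA: "f ` A = A'" and imB: "f ` B = B'" using bA bB by (auto simp: bij_betw_def)
    fix x assume x: "x \<in> verts G"
    then consider "x = u" | "x = v" | "x \<in> A" | "x \<in> B" using VG(1) by blast
    then show "f ` nbrs G x = nbrs F (f x)"
    proof cases
      case 1
      then show ?thesis using nG nF fu imA by simp
    next
      case 2
      then show ?thesis using nG nF fu imB by simp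
    next
      case 3
      then show ?thesis using nG(3) nF(3) fA(2) fu by simp
    next
      case 4
      then show ?thesis using nG(4) nF(4) fB(2) fu by simp
    qed
  qed
qed

lemma bipartite_shape_iso:
  assumes G: "bipartite_shape G A B" and F: "bipartite_shape F A' B'"
    and fin: "finite A" "finite B" "finite A'" "finite B'" and c: "card A = card A'" "card B = card B'"
  shows "G \<simeq> F"
proof -
  obtain \<alpha> \<beta> where \<alpha>: "bij_betw \<alpha> A A'" and \<beta>: "bij_betw \<beta> B B'"
    using fin c finite_same_card_bij by metis
  define f where "f x = (if x \<in> A then \<alpha> x else \<beta> x)" for x
  have VG: "verts G = A \<union> B" "A \<inter> B = {}"
    and nG: "\<And>a. a \<in> A \<Longrightarrow> nbrs G a = B" "\<And>b. b \<in> B \<Longrightarrow> nbrs G b = A"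
    using G by (auto simp: bipartite_shape_def)
  have VF: "verts F = A' \<union> B'" "A' \<inter> B' = {}"
    and nF: "\<And>a. a \<in> A' \<Longrightarrow> nbrs F a = B'" "\<And>b. b \<in> B' \<Longrightarrow> nbrs F b = A'"
    using F by (auto simp: bipartite_shape_def)
  have fB: "f b = \<beta> b" if "b \<in> B" for b using that VG by (auto simp: f_def)
  have bA: "bij_betw f A A'" using \<alpha> by (simp add: f_def cong: bij_betw_cong)
  have bB: "bij_betw f B B'" using \<beta> fB by (simp cong: bij_betw_cong)
  have "bij_betw f (verts G) (verts F)"
    unfolding VG(1) VF(1) by (intro bij_betw_combine bA bB VF(2))
  then show ?thesis
  proof (rule graph_iso_if_nbrs)
    have im: "f ` A = A'" "f ` B = B'" using bA bB by (auto simp: bij_betw_def)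
    fix x assume x: "x \<in> verts G"
    then consider "x \<in> A" | "x \<in> B" using VG(1) by blast
    then show "f ` nbrs G x = nbrs F (f x)"
    proof cases
      case 1
      then have "f x \<in> A'" using im by blast
      then show ?thesis using nG(1) nF(1) 1 im by simp
    next
      case 2
      then have "f x \<in> B'" using im by blast
      then show ?thesis using nG(2) nF(2) 2 im by simp
    qed
  qed
qed

text \<open>Two involutions with at most one fixed point each are conjugate once the sets have
  the same size, because the parity of the size decides whether there is a fixed point.
  The induction removes one two-element orbit on each side.\<close>

lemma involutions_conjugate:
  assumes "finite V" "finite W" "card V = card W"
    and "\<And>x. x \<in> V \<Longrightarrow> m x \<in> V \<and> m (m x) = x" "\<And>x y. x \<in> V \<Longrightarrow> y \<in> V \<Longrightarrow> m x = x \<Longrightarrow> m y = y \<Longrightarrow> x = y"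
    and "\<And>x. x \<in> W \<Longrightarrow> k x \<in> W \<and> k (k x) = x" "\<And>x y. x \<in> W \<Longrightarrow> y \<in> W \<Longrightarrow> k x = x \<Longrightarrow> k y = y \<Longrightarrow> x = y"
  shows "\<exists>f. bij_betw f V W \<and> (\<forall>x\<in>V. f (m x) = k (f x))"
  using assms
proof (induction "card V" arbitrary: V W rule: less_induct)
  case less
  show ?case
  proof (cases "card V \<le> 1")
    case True
    obtain f where f: "bij_betw f V W" using finite_same_card_bij less.prems(1-3) by blast
    have one: "a = b" if "a \<in> W" "b \<in> W" for a b
      using True less.prems(2,3) that by (metis card_le_Suc0_iff_eq One_nat_def)
    have "f (m x) = k (f x)" if "x \<in> V" for x
      using one that less.prems(4,6) bij_betwE[OF f] by blast
    then show ?thesis using f by blast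
  next
    case False
    have moved: "\<exists>x\<in>U. h x \<noteq> x" if "finite U" "\<not> card U \<le> 1"
      "\<And>x y. x \<in> U \<Longrightarrow> y \<in> U \<Longrightarrow> h x = x \<Longrightarrow> h y = y \<Longrightarrow> x = y" for U :: "'c set" and h
      using that by (metis card_le_Suc0_iff_eq One_nat_def)
    obtain x where x: "x \<in> V" "m x \<noteq> x" using moved[of V m] False less.prems by metis
    obtain y where y: "y \<in> W" "k y \<noteq> y"
      using False less.prems(2,3,7) by (metis card_le_Suc0_iff_eq One_nat_def)
    let ?V = "V - {x, m x}" and ?W = "W - {y, k y}"
    have mx: "m x \<in> V" "m (m x) = x" and ky: "k y \<in> W" "k (k y) = y"
      using less.prems x y by auto
    have cV: "card ?V = card V - 2" using less.prems(1) x mx by (simp add: card_Diff_subset)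
    have cW: "card ?W = card W - 2" using less.prems(2) y ky by (simp add: card_Diff_subset)
    have "\<exists>f. bij_betw f ?V ?W \<and> (\<forall>x\<in>?V. f (m x) = k (f x))"
    proof (rule less.hyps)
      show "card ?V < card V" using cV False by simp
      show "card ?V = card ?W" using cV cW less.prems(3) by simp
      show "m z \<in> ?V \<and> m (m z) = z" if "z \<in> ?V" for z
        using less.prems(4)[of z] that mx(2) by auto
      show "k z \<in> ?W \<and> k (k z) = z" if "z \<in> ?W" for z
        using less.prems(6)[of z] that ky(2) by auto
    qed (use less.prems in auto)
    then obtain f where f: "bij_betw f ?V ?W" "\<forall>x\<in>?V. f (m x) = k (f x)" by blast
    define f' where "f' = f(x := y, m x := k y)"
    have "bij_betw f' ?V ?W" using f(1) bij_betw_cong[of ?V f' f ?W] by (auto simp: f'_def)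
    moreover have "bij_betw f' {x, m x} {y, k y}"
      using x y by (auto simp: f'_def bij_betw_def inj_on_def)
    ultimately have "bij_betw f' (?V \<union> {x, m x}) (?W \<union> {y, k y})"
      by (intro bij_betw_combine) auto
    moreover have "?V \<union> {x, m x} = V" "?W \<union> {y, k y} = W" using x y mx ky by auto
    ultimately have "bij_betw f' V W" by simp
    moreover have "f' (m z) = k (f' z)" if z: "z \<in> V" for z
    proof (cases "z \<in> {x, m x}")
      case True
      then show ?thesis using x y mx ky by (auto simp: f'_def)
    next
      case False
      then have "m z \<noteq> x" "m z \<noteq> m x" using less.prems(4)[OF z] mx by auto
      then show ?thesis using False z f(2) by (auto simp: f'_def)
    qed
    ultimately show ?thesis by blast
  qed
qed

text \<open>The involution exchanging the two ends of each edge of the missing matching,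
  with the vertex off the matching, if any, as fixed point.\<close>

lemma co_matching_mate:
  assumes sim: "simple_graph G" and sh: "co_matching_shape G"
  obtains m where "\<And>x. x \<in> verts G \<Longrightarrow> m x \<in> verts G \<and> m (m x) = x"
    "\<And>x. x \<in> verts G \<Longrightarrow> nbrs G x = verts G - {x, m x}"
proof -
  let ?V = "verts G"
  have fin: "finite ?V" using sim by (simp add: simple_graph_def)
  have irr: "x \<notin> nbrs G x" for x using simple_graph_edgeD[OF sim, of x x] by (auto simp: nbrs_def)
  have sym: "y \<in> nbrs G x" if "x \<in> nbrs G y" "y \<in> ?V" for x y
    using that by (auto simp: nbrs_def insert_commute)
  have uniq: "y = z" if "x \<in> ?V" "y \<in> ?V - {x} - nbrs G x" "z \<in> ?V - {x} - nbrs G x" for x y z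
  proof (rule ccontr)
    assume "y \<noteq> z"
    then have "card {x, y, z} = 3" using that by auto
    moreover have "{x, y, z} \<subseteq> ?V - nbrs G x" using that irr by auto
    ultimately have "3 \<le> card (?V - nbrs G x)" using fin by (metis card_mono finite_Diff)
    moreover have "nbrs G x \<subseteq> ?V" by (auto simp: nbrs_def)
    ultimately have "3 \<le> card ?V - card (nbrs G x)" using fin
      by (metis card_Diff_subset finite_subset)
    then show False using sh that(1) unfolding co_matching_shape_def by fastforce
  qed
  define m where "m x = (if \<exists>y. y \<in> ?V - {x} - nbrs G x then SOME y. y \<in> ?V - {x} - nbrs G x else x)" for x
  have m: "m x \<in> ?V" "nbrs G x = ?V - {x, m x}" if x: "x \<in> ?V" for x
  proof -
    have "m x \<in> ?V \<and> nbrs G x = ?V - {x, m x}"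
    proof (cases "\<exists>y. y \<in> ?V - {x} - nbrs G x")
      case True
      then have mx: "m x \<in> ?V - {x} - nbrs G x" unfolding m_def using someI_ex[OF True] by simp
      then have "z \<in> nbrs G x" if "z \<in> ?V - {x, m x}" for z using uniq[OF x mx, of z] that by blast
      moreover have "nbrs G x \<subseteq> ?V" by (auto simp: nbrs_def)
      ultimately show ?thesis using mx irr by blast
    next
      case False
      then have "m x = x" unfolding m_def by (rule if_not_P)
      moreover have "nbrs G x \<subseteq> ?V" by (auto simp: nbrs_def)
      ultimately show ?thesis using False irr x by auto
    qed
    then show "m x \<in> ?V" "nbrs G x = ?V - {x, m x}" by auto
  qed
  have "m (m x) = x" if x: "x \<in> ?V" for x
  proof (cases "m x = x")
    case False
    have "m x \<notin> nbrs G x" using m[OF x] by blast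
    then have "x \<notin> nbrs G (m x)" using sym m(1)[OF x] by blast
    then have "x \<notin> ?V - {m x, m (m x)}" unfolding m(2)[OF m(1)[OF x]] .
    then show ?thesis using x False by simp
  qed simp
  then show thesis using m by (intro that) auto
qed

lemma co_matching_shape_iso:
  assumes G: "simple_graph G" "co_matching_shape G" and F: "simple_graph F" "co_matching_shape F"
    and c: "card (verts G) = card (verts F)"
  shows "G \<simeq> F"
proof -
  obtain m where m: "\<And>x. x \<in> verts G \<Longrightarrow> m x \<in> verts G \<and> m (m x) = x"
    "\<And>x. x \<in> verts G \<Longrightarrow> nbrs G x = verts G - {x, m x}"
    using co_matching_mate[OF G] by metis
  obtain k where k: "\<And>x. x \<in> verts F \<Longrightarrow> k x \<in> verts F \<and> k (k x) = x"
    "\<And>x. x \<in> verts F \<Longrightarrow> nbrs F x = verts F - {x, k x}"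
    using co_matching_mate[OF F] by metis
  have "\<exists>f. bij_betw f (verts G) (verts F) \<and> (\<forall>x\<in>verts G. f (m x) = k (f x))"
  proof (rule involutions_conjugate[OF _ _ c])
    show "finite (verts G)" "finite (verts F)" using G F by (auto simp: simple_graph_def)
    show "x = y" if "x \<in> verts G" "y \<in> verts G" "m x = x" "m y = y" for x y
    proof -
      have "nbrs G x = verts G - {x}" "nbrs G y = verts G - {y}" using m(2) that by auto
      then show ?thesis using G(2) that unfolding co_matching_shape_def by blast
    qed
    show "x = y" if "x \<in> verts F" "y \<in> verts F" "k x = x" "k y = y" for x y
    proof -
      have "nbrs F x = verts F - {x}" "nbrs F y = verts F - {y}" using k(2) that by auto
      then show ?thesis using F(2) that unfolding co_matching_shape_def by blast
    qed
  qed (use m k in auto)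
  then obtain f where f: "bij_betw f (verts G) (verts F)" "\<And>x. x \<in> verts G \<Longrightarrow> f (m x) = k (f x)"
    by blast
  show ?thesis
  proof (rule graph_iso_if_nbrs[OF f(1)])
    fix x assume x: "x \<in> verts G"
    have inj: "inj_on f (verts G)" and im: "f ` verts G = verts F"
      using f(1) by (auto simp: bij_betw_def)
    have "f ` nbrs G x = f ` verts G - f ` {x, m x}"
      unfolding m(2)[OF x] using x m(1)[OF x] by (subst inj_on_image_set_diff[OF inj]) auto
    also have "\<dots> = verts F - {f x, k (f x)}" using im f(2)[OF x] by simp
    also have "\<dots> = nbrs F (f x)" using k(2)[of "f x"] im x by blast
    finally show "f ` nbrs G x = nbrs F (f x)" .
  qed
qed

section \<open>The shapes of the listed graphs\<close>

lemma extremal_shapeI: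
  "double_star_shape G u v A B \<Longrightarrow> A \<noteq> {} \<Longrightarrow> extremal_shape G"
  "bipartite_shape G A B \<Longrightarrow> card A = 2 \<Longrightarrow> card B = 3 \<Longrightarrow> extremal_shape G"
  "co_matching_shape G \<Longrightarrow> extremal_shape G"
proof -
  show "double_star_shape G u v A B \<Longrightarrow> A \<noteq> {} \<Longrightarrow> extremal_shape G"
    unfolding extremal_shape_def by (intro disjI1 exI conjI)
  show "bipartite_shape G A B \<Longrightarrow> card A = 2 \<Longrightarrow> card B = 3 \<Longrightarrow> extremal_shape G"
    unfolding extremal_shape_def by (intro disjI2 disjI1 exI conjI)
  show "co_matching_shape G \<Longrightarrow> extremal_shape G"
    unfolding extremal_shape_def by (intro disjI2)
qed

lemma path_graph_shape: "double_star_shape (path_graph 4) 1 2 {0} {3}"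
proof -
  have V: "verts (path_graph 4) = {0, 1, 2, 3}" by (auto simp: path_graph_def)
  have E: "edges (path_graph 4) = {{0, 1}, {1, 2}, {2, 3}}"
  proof -
    have "{{i, Suc i} |i. Suc i < 4} = (\<lambda>i. {i, Suc i}) ` {0, 1, 2}" by force
    then show ?thesis by (simp add: path_graph_def eval_nat_numeral)
  qed
  show ?thesis
    unfolding double_star_shape_def nbrs_def V E by (auto simp: doubleton_eq_iff)
qed

lemma complete_bipartite_shape:
  "bipartite_shape (complete_bipartite m n) (Inl ` {..<m}) (Inr ` {..<n})"
  unfolding bipartite_shape_def nbrs_def complete_bipartite_def
  by (auto simp: doubleton_eq_iff Plus_def)

lemma double_star_graph_shape:
  "double_star_shape (double_star k l) (Inl (Inl 0)) (Inr (Inl 0))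
     (Inl ` Inr ` {..<k}) (Inr ` Inr ` {..<l})"
proof -
  let ?u = "Inl (Inl 0) :: (nat + nat) + (nat + nat)" and ?v = "Inr (Inl 0) :: (nat + nat) + (nat + nat)"
  have V: "verts (double_star k l) = {?u, ?v} \<union> (Inl ` Inr ` {..<k}) \<union> (Inr ` Inr ` {..<l})"
    by (auto simp: double_star_def add_edge_def disjoint_union_def complete_bipartite_def Plus_def)
  have E: "edges (double_star k l) = insert {?u, ?v}
      ((\<lambda>i. {?u, Inl (Inr i)}) ` {..<k} \<union> (\<lambda>i. {?v, Inr (Inr i)}) ` {..<l})"
  proof -
    have "{{Inl i, Inr j} |i j. i < 1 \<and> j < n} = (\<lambda>j. {Inl 0, Inr j :: nat + nat}) ` {..<n}" for n
      by auto
    then show ?thesis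
      by (simp add: double_star_def add_edge_def disjoint_union_def complete_bipartite_def image_image)
  qed
  show ?thesis
    unfolding double_star_shape_def nbrs_def V E by (auto simp: doubleton_eq_iff)
qed

lemma turan_graph_shape:
  assumes l: "2 \<le> l" and n: "n = 2 * l \<or> n = 2 * l - 1"
  shows "simple_graph (turan_graph n l)" "co_matching_shape (turan_graph n l)"
proof -
  let ?T = "turan_graph n l"
  have V: "verts ?T = {..<n}" by (simp add: turan_graph_def)
  have edge: "{i, j} \<in> edges ?T \<longleftrightarrow> i < n \<and> j < n \<and> i mod l \<noteq> j mod l" for i j
    by (auto simp: turan_graph_def doubleton_eq_iff)
  show "simple_graph ?T"
    by (auto simp: simple_graph_def turan_graph_def card_2_iff)
  have md: "i mod l = (if i < l then i else i - l)" if "i < n" for i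
    using that n by (auto simp: le_mod_geq)
  show "co_matching_shape ?T"
    unfolding co_matching_shape_def V
  proof (intro conjI ballI impI)
    show "3 \<le> card {..<n}" using l n by auto
    fix i assume i: "i \<in> {..<n}"
    let ?m = "if i < l then i + l else i - l"
    have "{..<n} - {i, ?m} \<subseteq> nbrs ?T i"
    proof
      fix j assume j: "j \<in> {..<n} - {i, ?m}"
      then have "i mod l \<noteq> j mod l" using i md[of i] md[of j] by (auto split: if_splits)
      then show "j \<in> nbrs ?T i" using i j by (auto simp: nbrs_def V edge)
    qed
    moreover have "finite (nbrs ?T i)" by (simp add: nbrs_def V)
    ultimately have "card ({..<n} - {i, ?m}) \<le> card (nbrs ?T i)" by (intro card_mono)
    moreover have "card {..<n} - card {i, ?m} \<le> card ({..<n} - {i, ?m})"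
      by (intro diff_card_le_card_Diff) simp
    moreover have "card {i, ?m} \<le> 2" by (simp add: card_insert_if)
    ultimately show "card {..<n} - 2 \<le> card (nbrs ?T i)" by linarith
  next
    have last: "i = l - 1" if i: "i < n" and full: "nbrs ?T i = {..<n} - {i}" for i
    proof (rule ccontr)
      assume ne: "i \<noteq> l - 1"
      let ?m = "if i < l then i + l else i - l"
      have m: "?m < n" "?m \<noteq> i" using i n ne l by auto
      then have "?m \<in> nbrs ?T i" using full by simp
      then have "i mod l \<noteq> ?m mod l" by (auto simp: nbrs_def edge)
      then show False using i m md[of i] md[of ?m] n by (auto split: if_splits)
    qed
    fix i j assume "i \<in> {..<n}" "j \<in> {..<n}"
      "nbrs ?T i = {..<n} - {i} \<and> nbrs ?T j = {..<n} - {j}"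
    then show "i = j" using last[of i] last[of j] by auto
  qed
qed

lemma double_star_shape_swap:
  "double_star_shape G u v A B \<Longrightarrow> double_star_shape G v u B A"
  unfolding double_star_shape_def by (auto simp: insert_commute)

lemma star_shape_iff:
  assumes "v \<notin> A"
  shows "bipartite_shape G {u} (insert v A) \<longleftrightarrow> double_star_shape G u v A {}"
proof
  assume b: "bipartite_shape G {u} (insert v A)"
  then have "verts G = {u} \<union> insert v A" "u \<notin> insert v A" "nbrs G u = insert v A"
    "x \<in> insert v A \<Longrightarrow> nbrs G x = {u}" for x
    unfolding bipartite_shape_def by auto
  then show "double_star_shape G u v A {}"
    unfolding double_star_shape_def using assms by (simp add: insert_commute)
next
  assume "double_star_shape G u v A {}"
  then show "bipartite_shape G {u} (insert v A)"
    unfolding double_star_shape_def bipartite_shape_def by auto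
qed

lemma extremal_shape_iff_listed:
  fixes G :: "'a graph"
  assumes sim: "simple_graph G"
  shows "extremal_shape G \<longleftrightarrow>
    (\<exists>k l :: nat. k \<ge> 1 \<and> l \<ge> 2 \<and>
       (G \<simeq> path_graph 4 \<or>
        G \<simeq> complete_bipartite 2 3 \<or>
        G \<simeq> complete_bipartite 1 l \<or>
        G \<simeq> double_star k l \<or>
        G \<simeq> turan_graph (2 * l) l \<or>
        G \<simeq> turan_graph (2 * l - 1) l))" (is "_ \<longleftrightarrow> ?listed")
proof
  have fin: "finite (verts G)" using sim by (simp add: simple_graph_def)
  have cl: "card (Inl ` {..<m} :: (nat + nat) set) = m" for m by (simp add: card_image)
  have cr: "card (Inr ` {..<m} :: (nat + nat) set) = m" for m by (simp add: card_image)
  have cll: "card (Inl ` Inr ` {..<m} :: ((nat + nat) + (nat + nat)) set) = m" for m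
    by (simp add: card_image)
  have crr: "card (Inr ` Inr ` {..<m} :: ((nat + nat) + (nat + nat)) set) = m" for m
    by (simp add: card_image)
  assume "extremal_shape G"
  then consider (star) u v A B where "double_star_shape G u v A B" "A \<noteq> {}"
    | (bip) A B where "bipartite_shape G A B" "card A = 2" "card B = 3"
    | (mat) "co_matching_shape G" unfolding extremal_shape_def by blast
  then show ?listed
  proof cases
    case star
    have finAB: "finite A" "finite B"
      using star fin by (auto simp: double_star_shape_def)
    then have A1: "1 \<le> card A" using star by (simp add: card_gt_0_iff Suc_le_eq)
    have ds: "G \<simeq> double_star (card A) (card B)"
      by (rule double_star_shape_iso[OF star(1) double_star_graph_shape])
        (use finAB in \<open>simp_all add: cll crr\<close>)
    have ds': "G \<simeq> double_star (card B) (card A)"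
      by (rule double_star_shape_iso[OF double_star_shape_swap[OF star(1)] double_star_graph_shape])
        (use finAB in \<open>simp_all add: cll crr\<close>)
    consider "card B = 0" | "card A = 1" "card B = 1" | "2 \<le> card B" | "1 \<le> card B" "2 \<le> card A"
      using A1 by linarith
    then show ?thesis
    proof cases
      case 1
      then have B: "B = {}" using finAB by simp
      have v: "v \<notin> A" using star(1) by (auto simp: double_star_shape_def)
      then have "bipartite_shape G {u} (insert v A)" using star_shape_iff star(1) B by metis
      then have "G \<simeq> complete_bipartite 1 (Suc (card A))"
        by (rule bipartite_shape_iso[OF _ complete_bipartite_shape])
          (use finAB v in \<open>simp_all add: cl cr\<close>)
      moreover have "2 \<le> Suc (card A)" using A1 by simp
      ultimately show ?thesis by blast
    next
      case 2
      have "G \<simeq> path_graph 4"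
        by (rule double_star_shape_iso[OF star(1) path_graph_shape]) (use finAB 2 in auto)
      then show ?thesis by blast
    next
      case 3
      then show ?thesis using ds A1 by blast
    next
      case 4
      then show ?thesis using ds' by blast
    qed
  next
    case bip
    then have "finite A" "finite B" by (auto intro: card_ge_0_finite)
    then have "G \<simeq> complete_bipartite 2 3"
      by (intro bipartite_shape_iso[OF bip(1) complete_bipartite_shape])
        (use bip in \<open>simp_all add: cl cr\<close>)
    then show ?thesis by blast
  next
    case mat
    define l where "l = (card (verts G) + 1) div 2"
    have c3: "3 \<le> card (verts G)" using mat by (simp add: co_matching_shape_def)
    then have l: "2 \<le> l" by (simp add: l_def)
    have c: "card (verts G) = 2 * l \<or> card (verts G) = 2 * l - 1"
      unfolding l_def by presburger
    have "G \<simeq> turan_graph (card (verts G)) l"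
      by (rule co_matching_shape_iso[OF sim mat turan_graph_shape[OF l c]])
        (simp add: turan_graph_def)
    then have "G \<simeq> turan_graph (2 * l) l \<or> G \<simeq> turan_graph (2 * l - 1) l"
      using c by auto
    then show ?thesis using l by (intro exI[of _ 1] exI[of _ l]) auto
  qed
next
  assume ?listed
  then obtain k l where kl: "1 \<le> k" "2 \<le> l" and
    listed: "G \<simeq> path_graph 4 \<or> G \<simeq> complete_bipartite 2 3 \<or> G \<simeq> complete_bipartite 1 l \<or>
     G \<simeq> double_star k l \<or> G \<simeq> turan_graph (2 * l) l \<or> G \<simeq> turan_graph (2 * l - 1) l" by blast
  have P4: "extremal_shape G" if iso: "G \<simeq> path_graph 4"
  proof -
    obtain g where g: "bij_betw g (verts (path_graph 4)) (verts G)"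
      "\<And>i. i \<in> verts (path_graph 4) \<Longrightarrow> nbrs G (g i) = g ` nbrs (path_graph 4) i"
      using graph_isoE[OF iso] by metis
    show ?thesis
      by (rule extremal_shapeI(1)[OF double_star_shape_image[OF path_graph_shape g]]) simp_all
  qed
  have K23: "extremal_shape G" if iso: "G \<simeq> complete_bipartite 2 3"
  proof -
    obtain g where g: "bij_betw g (verts (complete_bipartite 2 3)) (verts G)"
      "\<And>i. i \<in> verts (complete_bipartite 2 3) \<Longrightarrow> nbrs G (g i) = g ` nbrs (complete_bipartite 2 3) i"
      using graph_isoE[OF iso] by metis
    have inj: "inj_on g A" if "A \<subseteq> verts (complete_bipartite 2 3)" for A
      using g(1) that by (auto simp: bij_betw_def intro: inj_on_subset)
    have "card (g ` Inl ` {..<2}) = 2" "card (g ` Inr ` {..<3}) = 3"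
      by (subst card_image[OF inj]; force simp: complete_bipartite_def card_image)+
    with bipartite_shape_image[OF complete_bipartite_shape g] show ?thesis
      by (rule extremal_shapeI(2))
  qed
  have star: "extremal_shape G" if iso: "G \<simeq> complete_bipartite 1 l"
  proof -
    obtain g where g: "bij_betw g (verts (complete_bipartite 1 l)) (verts G)"
      "\<And>i. i \<in> verts (complete_bipartite 1 l) \<Longrightarrow> nbrs G (g i) = g ` nbrs (complete_bipartite 1 l) i"
      using graph_isoE[OF iso] by metis
    have inj: "inj_on g (verts (complete_bipartite 1 l))" using g(1) by (simp add: bij_betw_def)
    let ?A = "g ` Inr ` {1..<l}"
    have set: "Inr ` {..<l} = insert (Inr 0) (Inr ` {1..<l})" using kl by auto
    have "bipartite_shape G {g (Inl 0)} (insert (g (Inr 0)) ?A)"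
      using bipartite_shape_image[OF complete_bipartite_shape g] unfolding set
      by (simp add: lessThan_Suc)
    moreover have "g (Inr 0) \<notin> ?A"
    proof
      assume "g (Inr 0) \<in> ?A"
      then obtain i where "1 \<le> i" "i < l" "g (Inr 0) = g (Inr i)" by auto
      then show False using inj by (auto simp: inj_on_def complete_bipartite_def)
    qed
    ultimately have "double_star_shape G (g (Inl 0)) (g (Inr 0)) ?A {}"
      using star_shape_iff by metis
    moreover have "?A \<noteq> {}" using kl by auto
    ultimately show ?thesis by (rule extremal_shapeI(1))
  qed
  have dstar: "extremal_shape G" if iso: "G \<simeq> double_star k l"
  proof -
    obtain g where g: "bij_betw g (verts (double_star k l)) (verts G)"
      "\<And>i. i \<in> verts (double_star k l) \<Longrightarrow> nbrs G (g i) = g ` nbrs (double_star k l) i"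
      using graph_isoE[OF iso] by metis
    have "g ` Inl ` Inr ` {..<k} \<noteq> {}" using kl(1) by (auto simp: lessThan_empty_iff)
    with double_star_shape_image[OF double_star_graph_shape g] show ?thesis
      by (rule extremal_shapeI(1))
  qed
  have turan: "extremal_shape G" if iso: "G \<simeq> turan_graph n l" and n: "n = 2 * l \<or> n = 2 * l - 1" for n
  proof -
    obtain g where g: "bij_betw g (verts (turan_graph n l)) (verts G)"
      "\<And>i. i \<in> verts (turan_graph n l) \<Longrightarrow> nbrs G (g i) = g ` nbrs (turan_graph n l) i"
      using graph_isoE[OF iso] by metis
    show ?thesis
      by (rule extremal_shapeI(3)[OF co_matching_shape_image[OF turan_graph_shape(2)[OF kl(2) n] g]])
  qed
  show "extremal_shape G"
    using listed
  proof (elim disjE)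
    assume "G \<simeq> turan_graph (2 * l) l"
    then show "extremal_shape G" by (rule turan) simp
  next
    assume "G \<simeq> turan_graph (2 * l - 1) l"
    then show "extremal_shape G" by (rule turan) simp
  qed (fact P4 K23 star dstar)+
qed

section \<open>The listed graphs are minimally tough\<close>

text \<open>It suffices that some \<open>t\<close> separates the toughness of \<open>G\<close> from that of all graphs \<open>G - e\<close>. Since separators leave at least two
  components, the latter follows from a separator of fewer than \<open>2 * t\<close> vertices.\<close>

lemma minimally_toughI:
  assumes "0 \<le> t"
    and lower: "\<And>S. separator G S \<Longrightarrow> t * real (num_components (del_verts G S)) \<le> real (card S)"
    and drop: "\<And>e. e \<in> edges G \<Longrightarrow> \<exists>S. separator (del_edge G e) S \<and> real (card S) < 2 * t"
  shows "minimally_tough G"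
proof -
  have ge: "ereal t \<le> toughness G"
    unfolding toughness_def
  proof (intro INF_greatest)
    fix S assume "S \<in> {S. separator G S}"
    then have "separator G S" by simp
    then show "ereal t \<le> ereal (real (card S) / real (num_components (del_verts G S)))"
      using lower[of S] by (auto simp: separator_def pos_le_divide_eq)
  qed
  have "toughness (del_edge G e) < toughness G" if e: "e \<in> edges G" for e
  proof -
    obtain S where S: "separator (del_edge G e) S" "real (card S) < 2 * t" using drop[OF e] by blast
    let ?c = "num_components (del_verts (del_edge G e) S)"
    have c: "2 \<le> ?c" using S by (simp add: separator_def)
    then have "2 * t \<le> real ?c * t" using assms(1) by (intro mult_right_mono) auto
    with S(2) have "real (card S) < real ?c * t" by linarith
    then have "real (card S) / real ?c < t" using c by (simp add: pos_divide_less_eq mult.commute)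
    moreover have "toughness (del_edge G e) \<le> ereal (real (card S) / real ?c)"
      unfolding toughness_def using S by (intro INF_lower) simp
    ultimately show ?thesis using ge by (meson ereal_less_eq(3) le_less_trans less_ereal.simps(1) less_le_trans)
  qed
  moreover have "toughness G \<noteq> -\<infinity>" using ge by auto
  ultimately show ?thesis by (auto simp: minimally_tough_def minimally_t_tough_def)
qed

lemma separator_not_linked:
  assumes "separator G S" "x \<in> verts G - S"
  shows "\<exists>y\<in>verts G - S. \<not> linked (del_verts G S) y x"
proof (rule ccontr)
  assume "\<not> ?thesis"
  then have "num_components (del_verts G S) \<le> card {x}"
    by (intro num_components_le) (auto simp: verts_del_verts)
  then show False using assms by (simp add: separator_def)
qed

lemma linked_del_verts_edge:
  assumes "{x, y} \<in> edges G" "x \<in> verts G - S" "y \<in> verts G - S"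
  shows "linked (del_verts G S) x y"
  using assms by (intro linked_edge) (auto simp: verts_del_verts edge_del_verts_iff)

lemma edge_nbrsE:
  assumes "simple_graph G" "e \<in> edges G"
  obtains x y where "e = {x, y}" "x \<in> verts G" "y \<in> verts G" "y \<in> nbrs G x" "x \<noteq> y"
proof -
  obtain x y where "e = {x, y}" using assms unfolding simple_graph_def by (meson card_2_iff)
  then show thesis using assms simple_graph_edgeD[of G x y] by (intro that) (auto simp: nbrs_def)
qed

lemma isolated_separator_del_edge:
  assumes "simple_graph G" "S \<subseteq> verts G" "x \<in> verts G - S" "z \<in> verts G - S" "x \<noteq> z"
    and "nbrs G x \<subseteq> insert y S"
  shows "separator (del_edge G {x, y}) S"
proof (rule separatorI[of _ _ x z])
  have nl: "{x, w} \<notin> edges G - {{x, y}}" if "w \<in> verts G - S" for w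
    using that assms(6) by (auto simp: nbrs_def)
  show "\<not> linked (del_verts (del_edge G {x, y}) S) x z"
    using assms(5) nl
    by (intro not_linked_if_isolated) (auto simp: verts_del_verts edge_del_verts_iff del_edge_def)
qed (use assms in \<open>auto simp: del_edge_def simple_graph_def\<close>)

text \<open>The graph is a tree: it is connected, so its toughness is positive, and deleting any
  edge disconnects it.\<close>

lemma double_star_shape_minimally_tough:
  assumes sim: "simple_graph G" and sh: "double_star_shape G u v A B" and A: "A \<noteq> {}"
  shows "nontrivially_minimally_tough G"
proof -
  have fin: "finite (verts G)" using sim by (simp add: simple_graph_def)
  have VG: "verts G = {u, v} \<union> A \<union> B" "u \<noteq> v" "u \<notin> A \<union> B" "v \<notin> A \<union> B" "A \<inter> B = {}"
    and nu: "nbrs G u = insert v A" and nv: "nbrs G v = insert u B"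
    and nA: "\<And>a. a \<in> A \<Longrightarrow> nbrs G a = {u}" and nB: "\<And>b. b \<in> B \<Longrightarrow> nbrs G b = {v}"
    using sh by (auto simp: double_star_shape_def)
  have edge: "{x, y} \<in> edges G \<longleftrightarrow> y \<in> nbrs G x" for x y
    using simple_graph_edgeD[OF sim, of x y] by (auto simp: nbrs_def)
  have n: "0 < card (verts G)" using fin VG(1) by (auto simp: card_gt_0_iff)
  have "minimally_tough G"
  proof (rule minimally_toughI)
    let ?t = "1 / real (card (verts G))"
    show "0 \<le> ?t" by simp
    fix S assume S: "separator G S"
    have "S \<noteq> {}"
    proof
      assume S0: "S = {}"
      let ?H = "del_verts G {}"
      have vu: "linked ?H v u" using VG nv by (intro linked_del_verts_edge) (auto simp: edge)
      have "linked ?H x u" if x: "x \<in> verts G" for x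
      proof -
        consider "x = u" | "x = v" | "x \<in> A" | "x \<in> B" using x VG(1) by blast
        then show ?thesis
        proof cases
          case 1
          then show ?thesis using x linked_refl[of u ?H] by (simp add: verts_del_verts)
        next
          case 2
          then show ?thesis using vu by simp
        next
          case 3
          then show ?thesis using x VG(1) nA by (intro linked_del_verts_edge) (auto simp: edge)
        next
          case 4
          then have "linked ?H x v" using x VG(1) nB by (intro linked_del_verts_edge) (auto simp: edge)
          then show ?thesis using vu by (rule linked_trans)
        qed
      qed
      then show False using separator_not_linked[of G S u] S S0 VG(1) by auto
    qed
    moreover have "finite S" using S fin by (auto simp: separator_def intro: finite_subset)
    ultimately have "1 \<le> card S" by (simp add: card_gt_0_iff Suc_le_eq)
    moreover have "num_components (del_verts G S) \<le> card (verts (del_verts G S))"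
      using fin by (intro num_components_le_card_verts) (simp add: verts_del_verts)
    moreover have "card (verts (del_verts G S)) \<le> card (verts G)"
      using fin by (intro card_mono) (auto simp: verts_del_verts)
    ultimately have "real (num_components (del_verts G S)) / real (card (verts G)) \<le> 1" "1 \<le> real (card S)"
      using n by auto
    then show "?t * real (num_components (del_verts G S)) \<le> real (card S)" by simp
  next
    fix e assume "e \<in> edges G"
    then obtain x y where e: "e = {x, y}" "x \<in> verts G" "y \<in> verts G" "y \<in> nbrs G x" "x \<noteq> y"
      using edge_nbrsE[OF sim] by metis
    have leaf: "separator (del_edge G {a, b}) {}" if "a \<in> verts G" "nbrs G a = {b}" for a b
    proof -
      obtain z where "z \<in> verts G" "z \<noteq> a" using VG(1,2) by blast
      then show ?thesis using that by (intro isolated_separator_del_edge[OF sim]) auto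
    qed
    have middle: "separator (del_edge G {u, v}) {}"
    proof (rule separatorI[of _ _ u v])
      let ?H = "del_verts (del_edge G {u, v}) {}"
      show "\<not> linked ?H u v"
      proof
        assume "linked ?H u v"
        then have "v \<in> insert u A"
        proof (rule linked_closed)
          fix a b assume ab: "a \<in> insert u A" "{a, b} \<in> edges ?H"
          then have "b \<in> nbrs G a" "{a, b} \<noteq> {u, v}"
            by (auto simp: edge_del_verts_iff del_edge_def edge)
          then show "b \<in> insert u A" using ab nu nA by auto
        qed simp
        then show False using VG by auto
      qed
    qed (use VG(1) fin in \<open>auto simp: del_edge_def\<close>)
    have "separator (del_edge G e) {}"
    proof -
      have "x \<in> A \<union> B \<or> y \<in> A \<union> B \<or> {x, y} = {u, v}" using e VG(1) by auto
      then consider "x \<in> A \<union> B" | "y \<in> A \<union> B" | "{x, y} = {u, v}" by blast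
      then show ?thesis
      proof cases
        case 1
        then have "nbrs G x = {y}" using nA nB e by auto
        then show ?thesis using leaf e by simp
      next
        case 2
        have "x \<in> nbrs G y" using e by (auto simp: nbrs_def insert_commute)
        then have "nbrs G y = {x}" using nA nB 2 by auto
        then show ?thesis using leaf[of y x] e by (simp add: insert_commute)
      next
        case 3
        then show ?thesis using middle e by simp
      qed
    qed
    then show "\<exists>S. separator (del_edge G e) S \<and> real (card S) < 2 * (1 / real (card (verts G)))"
      using n by (intro exI[of _ "{}"]) auto
  qed
  moreover have "\<not> complete G"
  proof -
    obtain a where a: "a \<in> A" using A by blast
    then have "{a, v} \<notin> edges G" "a \<noteq> v" using VG nA by (auto simp: edge)
    then show ?thesis using a VG(1) unfolding complete_def by blast
  qed
  moreover have "{u, v} \<in> edges G" using nu by (simp add: edge)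
  ultimately show ?thesis by (auto simp: nontrivially_minimally_tough_def edgeless_def)
qed

text \<open>A separator contains one of the parts, so it has \<open>s \<ge> 2\<close> vertices and leaves at most
  \<open>5 - s \<le> 3 * s / 2\<close> components. After deleting an edge, removing the other vertex of
  the part of size two isolates one end of that edge.\<close>

lemma bipartite_2_3_shape_minimally_tough:
  assumes sim: "simple_graph G" and sh: "bipartite_shape G A B" and c: "card A = 2" "card B = 3"
  shows "nontrivially_minimally_tough G"
proof -
  have fin: "finite (verts G)" using sim by (simp add: simple_graph_def)
  have VG: "verts G = A \<union> B" "A \<inter> B = {}"
    and nA: "\<And>a. a \<in> A \<Longrightarrow> nbrs G a = B" and nB: "\<And>b. b \<in> B \<Longrightarrow> nbrs G b = A"
    using sh by (auto simp: bipartite_shape_def)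
  have edge: "{x, y} \<in> edges G \<longleftrightarrow> y \<in> nbrs G x" for x y
    using simple_graph_edgeD[OF sim, of x y] by (auto simp: nbrs_def)
  have finAB: "finite A" "finite B" using fin VG(1) by auto
  have n: "card (verts G) = 5" using VG finAB c by (simp add: card_Un_disjoint)
  obtain a1 a2 where A: "A = {a1, a2}" "a1 \<noteq> a2" using c(1) by (auto simp: card_2_iff)
  have "minimally_tough G"
  proof (rule minimally_toughI)
    show "0 \<le> (2 / 3 :: real)" by simp
    fix S assume S: "separator G S"
    then have SV: "S \<subseteq> verts G" "finite S" using fin by (auto simp: separator_def intro: finite_subset)
    have "A \<subseteq> S \<or> B \<subseteq> S"
    proof (rule ccontr)
      assume "\<not> (A \<subseteq> S \<or> B \<subseteq> S)"
      then obtain a b where ab: "a \<in> A - S" "b \<in> B - S" by blast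
      let ?H = "del_verts G S"
      have ba: "linked ?H b a" using ab VG(1) nB by (intro linked_del_verts_edge) (auto simp: edge)
      have "linked ?H x a" if x: "x \<in> verts G - S" for x
      proof (cases "x \<in> A")
        case True
        then have "linked ?H x b" using ab VG(1) nA x by (intro linked_del_verts_edge) (auto simp: edge)
        then show ?thesis using ba by (rule linked_trans)
      next
        case False
        then show ?thesis using ab VG(1) nB x by (intro linked_del_verts_edge) (auto simp: edge)
      qed
      then show False using separator_not_linked[OF S, of a] ab VG(1) by auto
    qed
    then have "card A \<le> card S \<or> card B \<le> card S" using card_mono[OF SV(2)] by blast
    then have s2: "2 \<le> card S" using c by linarith
    have "num_components (del_verts G S) \<le> card (verts (del_verts G S))"
      using fin by (intro num_components_le_card_verts) (simp add: verts_del_verts)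
    also have "\<dots> = 5 - card S" using SV n by (simp add: verts_del_verts card_Diff_subset)
    finally show "2 / 3 * real (num_components (del_verts G S)) \<le> real (card S)" using s2 by linarith
  next
    have sep: "\<exists>S. separator (del_edge G {b, a}) S \<and> card S = 1" if ab: "a \<in> A" "b \<in> B" for a b
    proof -
      obtain a' where a': "A = {a, a'}" "a \<noteq> a'" using A ab by blast
      have "separator (del_edge G {b, a}) {a'}"
        by (rule isolated_separator_del_edge[OF sim, of _ _ a]) (use ab a' VG nB in auto)
      then show ?thesis by (intro exI[of _ "{a'}"]) simp
    qed
    fix e assume "e \<in> edges G"
    then obtain x y where e: "e = {x, y}" "x \<in> verts G" "y \<in> verts G" "y \<in> nbrs G x"
      using edge_nbrsE[OF sim] by metis
    have "\<exists>S. separator (del_edge G e) S \<and> card S = 1"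
    proof (cases "x \<in> A")
      case True
      then show ?thesis using sep[of x y] e nA by (simp add: insert_commute)
    next
      case False
      then show ?thesis using sep[of y x] e nB VG(1) by auto
    qed
    then show "\<exists>S. separator (del_edge G e) S \<and> real (card S) < 2 * (2 / 3)" by auto
  qed
  moreover have "\<not> complete G"
  proof -
    have "{a1, a2} \<notin> edges G" using A VG(2) nA[of a1] by (auto simp: edge)
    then show ?thesis using A VG(1) unfolding complete_def by blast
  qed
  moreover have "edges G \<noteq> {}"
  proof -
    obtain b where "b \<in> B" using c(2) by fastforce
    then have "{a1, b} \<in> edges G" using A nA[of a1] by (simp add: edge)
    then show ?thesis by blast
  qed
  ultimately show ?thesis by (simp add: nontrivially_minimally_tough_def edgeless_def)
qed

text \<open>A separator leaves exactly two non-adjacent vertices, because any third vertex is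
  adjacent to both. One end \<open>x\<close> of a deleted edge \<open>{x, y}\<close> has a non-neighbour, and \<open>x\<close>
  becomes isolated when everything but \<open>x\<close>, \<open>y\<close> and that non-neighbour is removed.\<close>

lemma co_matching_shape_minimally_tough:
  assumes sim: "simple_graph G" and sh: "co_matching_shape G"
  shows "nontrivially_minimally_tough G"
proof -
  let ?V = "verts G"
  have fin: "finite ?V" using sim by (simp add: simple_graph_def)
  obtain m where m: "\<And>x. x \<in> ?V \<Longrightarrow> m x \<in> ?V \<and> m (m x) = x"
    and nb: "\<And>x. x \<in> ?V \<Longrightarrow> nbrs G x = ?V - {x, m x}"
    using co_matching_mate[OF sim sh] by metis
  have fixed: "x = y" if "x \<in> ?V" "y \<in> ?V" "m x = x" "m y = y" for x y
  proof -
    have "nbrs G x = ?V - {x}" "nbrs G y = ?V - {y}" using nb that by auto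
    then show ?thesis using sh that unfolding co_matching_shape_def by blast
  qed
  have n: "3 \<le> card ?V" using sh by (simp add: co_matching_shape_def)
  have edge: "{x, y} \<in> edges G \<longleftrightarrow> y \<in> nbrs G x" for x y
    using simple_graph_edgeD[OF sim, of x y] by (auto simp: nbrs_def)
  have "minimally_tough G"
  proof (rule minimally_toughI)
    let ?t = "(real (card ?V) - 2) / 2"
    show "0 \<le> ?t" using n by simp
    fix S assume S: "separator G S"
    then have SV: "S \<subseteq> ?V" "finite S" using fin by (auto simp: separator_def intro: finite_subset)
    let ?H = "del_verts G S"
    have "?V - S \<noteq> {}"
    proof
      assume "?V - S = {}"
      then have "num_components ?H \<le> card ({} :: 'a set)"
        by (intro num_components_le) (auto simp: verts_del_verts)
      then show False using S by (simp add: separator_def)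
    qed
    then obtain x where x: "x \<in> ?V - S" by blast
    obtain y where y: "y \<in> ?V - S" "\<not> linked ?H y x" using separator_not_linked[OF S x] by blast
    have adj: "linked ?H a b" if "a \<in> ?V - S" "b \<in> ?V - S" "b \<noteq> a" "b \<noteq> m a" for a b
      using that nb[of a] by (intro linked_del_verts_edge) (auto simp: edge)
    have xy: "x \<noteq> y" using y linked_refl[of y ?H] by (auto simp: verts_del_verts)
    have my: "m y = x" using adj[of y x] x y xy by metis
    have "z = x \<or> z = y" if z: "z \<in> ?V - S" for z
    proof (rule ccontr)
      assume ne: "\<not> (z = x \<or> z = y)"
      have "m z \<noteq> x" using m[of z] m[of y] my ne z y by auto
      then have "linked ?H z x" using adj[of z x] z x ne by auto
      moreover have "linked ?H y z" using adj[of y z] z y ne my by auto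
      ultimately show False using y linked_trans by metis
    qed
    then have VS: "?V - S = {x, y}" using x y by auto
    have "num_components ?H \<le> card (verts ?H)"
      using fin by (intro num_components_le_card_verts) (simp add: verts_del_verts)
    then have c2: "num_components ?H \<le> 2" using VS xy by (simp add: verts_del_verts)
    have "card (?V - S) = card ?V - card S" using SV by (simp add: card_Diff_subset)
    then have "real (card ?V) - 2 = real (card S)" using VS xy n by simp
    then show "?t * real (num_components ?H) \<le> real (card S)"
      using mult_left_mono[of "real (num_components ?H)" 2 ?t] c2 n by simp
  next
    have sep: "\<exists>S. separator (del_edge G {x, y}) S \<and> card S = card ?V - 3"
      if xy: "x \<in> ?V" "y \<in> ?V" "y \<in> nbrs G x" "m x \<noteq> x" for x y
    proof -
      let ?S = "?V - {x, y, m x}"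
      have ne: "y \<noteq> x" "y \<noteq> m x" using xy nb by auto
      have "separator (del_edge G {x, y}) ?S"
        by (rule isolated_separator_del_edge[OF sim, of _ _ "m x"]) (use xy m nb in auto)
      moreover have "card ?S = card ?V - 3"
        using xy ne m fin by (subst card_Diff_subset) auto
      ultimately show ?thesis by blast
    qed
    fix e assume "e \<in> edges G"
    then obtain x y where e: "e = {x, y}" "x \<in> ?V" "y \<in> ?V" "y \<in> nbrs G x" "x \<noteq> y"
      using edge_nbrsE[OF sim] by metis
    have e': "x \<in> nbrs G y" using e by (auto simp: nbrs_def insert_commute)
    have "m x \<noteq> x \<or> m y \<noteq> y" using fixed e by blast
    then have "\<exists>S. separator (del_edge G e) S \<and> card S = card ?V - 3"
      using sep[of x y] sep[of y x] e e' by (auto simp: insert_commute)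
    then show "\<exists>S. separator (del_edge G e) S \<and> real (card S) < 2 * ((real (card ?V) - 2) / 2)"
      using n by auto
  qed
  moreover obtain x y where xy: "x \<in> ?V" "y \<in> ?V" "x \<noteq> y" "m x \<noteq> x"
  proof -
    obtain x y where "x \<in> ?V" "y \<in> ?V" "x \<noteq> y"
      using n fin card_le_Suc0_iff_eq[of ?V] by fastforce
    then show thesis using that fixed by metis
  qed
  moreover have "\<not> complete G"
  proof -
    have "{x, m x} \<notin> edges G" using nb xy by (simp add: edge)
    then show ?thesis using m xy unfolding complete_def by metis
  qed
  moreover have "edges G \<noteq> {}"
  proof -
    have "card {x, m x} \<le> 2" by (simp add: card_insert_if)
    then have "\<not> ?V \<subseteq> {x, m x}" using n card_mono[of "{x, m x}" ?V] by fastforce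
    then obtain z where "z \<in> nbrs G x" using nb[OF xy(1)] by blast
    then show ?thesis by (auto simp: nbrs_def)
  qed
  ultimately show ?thesis by (simp add: nontrivially_minimally_tough_def edgeless_def)
qed

theorem theorem1p3:
  fixes G :: "'a graph"
  assumes "simple_graph G"
    and "co_chordal G"
    and "co_diameter G \<ge> 3"
  shows "nontrivially_minimally_tough G \<longleftrightarrow>
    (\<exists>k l :: nat. k \<ge> 1 \<and> l \<ge> 2 \<and>
       (G \<simeq> path_graph 4 \<or>
        G \<simeq> complete_bipartite 2 3 \<or>
        G \<simeq> complete_bipartite 1 l \<or>
        G \<simeq> double_star k l \<or>
        G \<simeq> turan_graph (2 * l) l \<or>
        G \<simeq> turan_graph (2 * l - 1) l))"
proof -
  have "nontrivially_minimally_tough G \<longleftrightarrow> extremal_shape G"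
  proof
    assume "nontrivially_minimally_tough G"
    then have min: "minimally_tough G" and nc: "\<not> complete G"
      by (auto simp: nontrivially_minimally_tough_def)
    obtain t where t: "toughness G = ereal t" using toughness_finite[OF assms(1) nc] .
    have "minimally_tough_graph G t"
      using assms(1) t min
      by unfold_locales (auto simp: minimally_tough_def minimally_t_tough_def)
    then show "extremal_shape G"
      using minimally_tough_graph.extremal_shape_if_co_chordal assms nc by blast
  next
    assume "extremal_shape G"
    then consider u v A B where "double_star_shape G u v A B" "A \<noteq> {}"
      | A B where "bipartite_shape G A B" "card A = 2" "card B = 3"
      | "co_matching_shape G" unfolding extremal_shape_def by blast
    then show "nontrivially_minimally_tough G"
      using double_star_shape_minimally_tough[OF assms(1)]
        bipartite_2_3_shape_minimally_tough[OF assms(1)]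
        co_matching_shape_minimally_tough[OF assms(1)] by cases
  qed
  then show ?thesis using extremal_shape_iff_listed[OF assms(1)] by simp
qed

end
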